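(* If $T$ is a subcubic tree of order $n$ and dissociation number $\psi$, then $\Phi(T)\le 1.466^{4n-5\psi+2}$.
   Context: All graphs are finite, simple and undirected. A subcubic tree is a tree of maximum degree at most $3$. A dissociation set in a graph $G$ is a vertex subset $F$ such that the induced subgraph $G[F]$ has maximum degree at most $1$; a maximum dissociation set is one of maximum cardinality, and the dissociation number $\psi(G)$ is that cardinality. $\Phi(G)$ denotes the number of maximum dissociation sets of $G$. *)

theory Defs
  imports Complex_Main
begin

definition simple_graph :: "'a set \<Rightarrow> 'a set set \<Rightarrow> bool" where
  "simple_graph V E \<longleftrightarrow> finite V \<and> (\<forall>e\<in>E. e \<subseteq> V \<and> card e = 2)"

definition adj :: "'a set set \<Rightarrow> 'a \<Rightarrow> 'a \<Rightarrow> bool" where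
  "adj E u v \<longleftrightarrow> {u, v} \<in> E"

definition degree :: "'a set set \<Rightarrow> 'a \<Rightarrow> nat" where
  "degree E v = card {u. {u, v} \<in> E}"

definition connected_graph :: "'a set \<Rightarrow> 'a set set \<Rightarrow> bool" where
  "connected_graph V E \<longleftrightarrow> V \<noteq> {} \<and> (\<forall>u\<in>V. \<forall>v\<in>V. (adj E)\<^sup>*\<^sup>* u v)"

definition is_cycle :: "'a set set \<Rightarrow> 'a list \<Rightarrow> bool" where
  "is_cycle E xs \<longleftrightarrow> length xs \<ge> 3 \<and> distinct xs \<and>
     (\<forall>i. Suc i < length xs \<longrightarrow> adj E (xs ! i) (xs ! Suc i)) \<and>
     adj E (last xs) (hd xs)"

definition acyclic_graph :: "'a set set \<Rightarrow> bool" where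
  "acyclic_graph E \<longleftrightarrow> (\<nexists>xs. is_cycle E xs)"

definition is_tree :: "'a set \<Rightarrow> 'a set set \<Rightarrow> bool" where
  "is_tree V E \<longleftrightarrow> simple_graph V E \<and> connected_graph V E \<and> acyclic_graph E"

definition subcubic_tree :: "'a set \<Rightarrow> 'a set set \<Rightarrow> bool" where
  "subcubic_tree V E \<longleftrightarrow> is_tree V E \<and> (\<forall>v\<in>V. degree E v \<le> 3)"

definition dissociation_set :: "'a set \<Rightarrow> 'a set set \<Rightarrow> 'a set \<Rightarrow> bool" where
  "dissociation_set V E F \<longleftrightarrow> F \<subseteq> V \<and>
     (\<forall>v\<in>F. card {u \<in> F. {u, v} \<in> E} \<le> 1)"

definition dissociation_number :: "'a set \<Rightarrow> 'a set set \<Rightarrow> nat" where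
  "dissociation_number V E = Max (card ` {F. dissociation_set V E F})"

definition max_dissociation_set :: "'a set \<Rightarrow> 'a set set \<Rightarrow> 'a set \<Rightarrow> bool" where
  "max_dissociation_set V E F \<longleftrightarrow> dissociation_set V E F \<and>
     card F = dissociation_number V E"

definition num_max_dissociation_sets :: "'a set \<Rightarrow> 'a set set \<Rightarrow> nat" where
  "num_max_dissociation_sets V E = card {F. max_dissociation_set V E F}"

end

theory Submission
  imports Defs "HOL-Computational_Algebra.Polynomial" "HOL-Library.Tree"
begin

text \<open>
  Rooted at a leaf, a subcubic tree is a binary tree. For a rooted tree take the polynomials that
  count, by cardinality, the dissociation sets avoiding the root, those containing it as an isolated
  vertex, and all of them. Joining two rooted trees below a new root acts on these triples by
  multiplication and addition, and the theorem only concerns leading terms. The differences of the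
  three degrees leave three types of triples. Once the leading coefficients are scaled by
  \<open>1.466\<close> to the power \<open>5 * m - 4 * n\<close>, where \<open>m\<close> is the largest of the degrees and \<open>n\<close> the
  number of vertices, joining becomes one of six bilinear maps depending on the types only. These
  maps preserve a family of regions, a polyhedron and a point for each type, that lie in the
  half-space where the scaled number of maximum dissociation sets is at most the square of
  \<open>1.466\<close>. The empty tree is a legitimate argument of the join, so that vertices with fewer than two
  children need no separate treatment.
\<close>

section \<open>Binary trees as graphs\<close>

text \<open>A set with at most one element: a missing child then contributes no edge to its parent,
  and the equations for \<open>Node\<close> need no case distinction.\<close>

fun root_set :: "'a tree \<Rightarrow> 'a set" where
  "root_set Leaf = {}"
| "root_set (Node l a r) = {a}"

fun tree_edges :: "'a tree \<Rightarrow> 'a set set" where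
  "tree_edges Leaf = {}"
| "tree_edges (Node l a r) =
     tree_edges l \<union> tree_edges r \<union> (\<lambda>b. {a, b}) ` (root_set l \<union> root_set r)"

fun distinct_tree :: "'a tree \<Rightarrow> bool" where
  "distinct_tree Leaf \<longleftrightarrow> True"
| "distinct_tree (Node l a r) \<longleftrightarrow> distinct_tree l \<and> distinct_tree r \<and>
     a \<notin> set_tree l \<and> a \<notin> set_tree r \<and> set_tree l \<inter> set_tree r = {}"

lemma root_set_subset: "root_set t \<subseteq> set_tree t"
  by (cases t) auto

lemma root_set_cases: "root_set t = {} \<or> (\<exists>b. root_set t = {b})"
  by (cases t) auto

lemma tree_edges_subset: "e \<in> tree_edges t \<Longrightarrow> e \<subseteq> set_tree t"
  by (induction t) (use root_set_subset in fastforce)+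

lemma card_set_tree: "distinct_tree t \<Longrightarrow> card (set_tree t) = size t"
  by (induction t) (auto simp: card_Un_disjoint)

section \<open>From subcubic trees to binary trees\<close>

lemma successively_conv_nth:
  "successively P xs \<longleftrightarrow> (\<forall>i. Suc i < length xs \<longrightarrow> P (xs ! i) (xs ! Suc i))"
proof (induction xs)
  case (Cons x xs)
  then show ?case
    by (cases xs) (auto simp: nth_Cons split: nat.splits)
qed simp

text \<open>Trades indices for \<open>successively\<close>, whose rules for cons and append make it
  easy to build cycles from paths.\<close>

lemma is_cycle_iff:
  "is_cycle E xs \<longleftrightarrow> length xs \<ge> 3 \<and> distinct xs \<and> successively (adj E) xs \<and> adj E (last xs) (hd xs)"
  unfolding is_cycle_def successively_conv_nth by blast

lemma adj_commute: "adj E u v \<longleftrightarrow> adj E v u"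
  unfolding adj_def by (simp add: insert_commute)

lemma rtranclp_adj_commute: "(adj E)\<^sup>*\<^sup>* u v \<Longrightarrow> (adj E)\<^sup>*\<^sup>* v u"
  by (induction rule: rtranclp_induct) (simp, metis adj_commute converse_rtranclp_into_rtranclp)

text \<open>A path is built from its end. If the new start already occurs on it, everything before
  that occurrence is dropped.\<close>

lemma rtranclp_imp_distinct_path:
  assumes "R\<^sup>*\<^sup>* u v"
  shows "\<exists>xs. xs \<noteq> [] \<and> hd xs = u \<and> last xs = v \<and> distinct xs \<and> successively R xs"
  using assms
proof (induction rule: converse_rtranclp_induct)
  case base
  show ?case by (rule exI[of _ "[v]"]) simp
next
  case (step u w)
  then obtain xs where xs: "xs \<noteq> []" "hd xs = w" "last xs = v" "distinct xs" "successively R xs"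
    by blast
  show ?case
  proof (cases "u \<in> set xs")
    case True
    then obtain ys zs where "xs = ys @ u # zs" by (auto dest: split_list)
    then show ?thesis using xs
      by (intro exI[of _ "u # zs"]) (auto simp: successively_append_iff)
  next
    case False
    then show ?thesis using xs step(1)
      by (intro exI[of _ "u # xs"]) (auto simp: successively_Cons)
  qed
qed

lemma successively_imp_rtranclp:
  "successively R xs \<Longrightarrow> x \<in> set xs \<Longrightarrow> R\<^sup>*\<^sup>* (hd xs) x"
proof (induction xs)
  case (Cons y ys)
  then show ?case
    by (cases ys) (auto intro: converse_rtranclp_into_rtranclp)
qed simp

lemma edge_doubleton:
  assumes "simple_graph V E" "e \<in> E" "r \<in> e"
  obtains c where "e = {c, r}" "c \<noteq> r" "c \<in> V" "r \<in> V"
proof -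
  from assms have "card e = 2" "e \<subseteq> V" unfolding simple_graph_def by auto
  then obtain x y where "e = {x, y}" "x \<noteq> y" by (auto simp: card_2_iff)
  then show ?thesis using that[of x] that[of y] assms(3) \<open>e \<subseteq> V\<close> by (auto simp: insert_commute)
qed

lemma edge_ends:
  assumes "simple_graph V E" "{u, v} \<in> E"
  shows "u \<in> V" "v \<in> V" "u \<noteq> v"
  using assms unfolding simple_graph_def by (auto simp: card_2_iff doubleton_eq_iff)

lemma finite_neighbours:
  assumes "simple_graph V E"
  shows "finite {u. {u, v} \<in> E}"
proof (rule finite_subset[of _ V])
  show "{u. {u, v} \<in> E} \<subseteq> V" using edge_ends(1)[OF assms] by auto
  show "finite V" using assms unfolding simple_graph_def by simp
qed

text \<open>The first vertex of a longest path has no neighbour but the second one.\<close>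
lemma acyclic_imp_leaf:
  assumes simple: "simple_graph V E" and acyc: "acyclic_graph E" and "V \<noteq> {}"
  obtains v where "v \<in> V" "Defs.degree E v \<le> 1"
proof -
  define path where "path xs \<longleftrightarrow> xs \<noteq> [] \<and> set xs \<subseteq> V \<and> distinct xs \<and> successively (adj E) xs" for xs
  have fin: "finite V" using simple unfolding simple_graph_def by simp
  obtain v0 where "v0 \<in> V" using \<open>V \<noteq> {}\<close> by auto
  then have "path [v0]" unfolding path_def by simp
  moreover have "\<forall>xs. path xs \<longrightarrow> length xs < Suc (card V)"
    unfolding path_def using fin by (metis card_mono distinct_card le_imp_less_Suc)
  ultimately obtain xs where xs: "path xs" "\<And>ys. path ys \<Longrightarrow> length ys \<le> length xs"
    using ex_has_greatest_nat[of path "[v0]" length "Suc (card V)"] by (metis less_imp_le)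
  then obtain x ys where x: "xs = x # ys" unfolding path_def by (cases xs) auto
  \<comment> \<open>For \<open>ys = []\<close> the vertex \<open>hd ys\<close> is unspecified. The
    inclusion still holds, because every neighbour of \<open>x\<close> lies in \<open>ys\<close>;
    the degree bound only needs some singleton.\<close>
  have "{u. {u, x} \<in> E} \<subseteq> {hd ys}"
  proof
    fix u assume "u \<in> {u. {u, x} \<in> E}"
    then have u: "adj E u x" "u \<in> V" "u \<noteq> x" using edge_ends[OF simple] unfolding adj_def by auto
    have "u \<in> set ys"
    proof (rule ccontr)
      assume "u \<notin> set ys"
      then have "path (u # xs)" using u xs(1) unfolding path_def x by (auto simp: successively_Cons)
      then show False using xs(2) by fastforce
    qed
    then obtain as bs where ys: "ys = as @ u # bs" by (auto dest: split_list)
    \<comment> \<open>A neighbour further along the path would close a cycle with the segment from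
      \<open>x\<close> to it.\<close>
    have "as = []"
    proof (rule ccontr)
      assume "as \<noteq> []"
      then have "is_cycle E (x # as @ [u])"
        using xs(1) u unfolding path_def x ys is_cycle_iff
        by (cases as) (auto simp: successively_append_iff successively_Cons hd_append)
      then show False using acyc unfolding acyclic_graph_def by blast
    qed
    then show "u \<in> {hd ys}" using ys by simp
  qed
  then have "Defs.degree E x \<le> card {hd ys}" unfolding Defs.degree_def by (intro card_mono) auto
  then show ?thesis using that[of x] xs(1) unfolding path_def x by auto
qed

section \<open>Branches of a tree at a vertex\<close>

text \<open>For a neighbour \<open>c\<close> of \<open>r\<close> this is the component of
  \<open>c\<close> after deletion of \<open>r\<close>. Deleting the edges at \<open>r\<close>
  instead of the vertex keeps plain reachability as the definition.\<close>

definition branch :: "'a set set \<Rightarrow> 'a \<Rightarrow> 'a \<Rightarrow> 'a set" where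
  "branch E r c = {v. (adj {e \<in> E. r \<notin> e})\<^sup>*\<^sup>* c v}"

definition induced_edges :: "'a set set \<Rightarrow> 'a set \<Rightarrow> 'a set set" where
  "induced_edges E S = {e \<in> E. e \<subseteq> S}"

context
  fixes V :: "'a set" and E :: "'a set set" and r :: 'a
  assumes tree: "is_tree V E" and r: "r \<in> V"
begin

lemma tree_simple: "simple_graph V E" and tree_acyclic: "acyclic_graph E"
  using tree unfolding is_tree_def by auto

lemma self_in_branch: "c \<in> branch E r c"
  unfolding branch_def by simp

lemma branch_subset:
  assumes "{c, r} \<in> E"
  shows "branch E r c \<subseteq> V - {r}"
proof
  fix v assume "v \<in> branch E r c"
  then have "(adj {e \<in> E. r \<notin> e})\<^sup>*\<^sup>* c v" unfolding branch_def by simp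
  then show "v \<in> V - {r}"
  proof (induction rule: rtranclp_induct)
    case base
    then show ?case using edge_ends[OF tree_simple assms] by auto
  next
    case (step y z)
    then have "{y, z} \<in> E" "r \<notin> {y, z}" unfolding adj_def by auto
    then show ?case using edge_ends[OF tree_simple] by auto
  qed
qed

lemma edge_in_branch:
  assumes "e \<in> E" "r \<notin> e" "u \<in> e" "u \<in> branch E r c"
  shows "e \<subseteq> branch E r c"
proof -
  obtain v where "e = {v, u}" using edge_doubleton[OF tree_simple assms(1,3)] by metis
  then have "adj {e \<in> E. r \<notin> e} u v" using assms unfolding adj_def by (auto simp: insert_commute)
  then show ?thesis
    using assms(4) \<open>e = {v, u}\<close> unfolding branch_def by (auto intro: rtranclp.rtrancl_into_rtrancl)
qed

lemma branch_is_tree: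
  assumes "{c, r} \<in> E"
  shows "is_tree (branch E r c) (induced_edges E (branch E r c))" (is "is_tree ?V ?E")
proof -
  have "simple_graph ?V ?E"
    using tree_simple branch_subset[OF assms] finite_subset[of ?V V]
    unfolding simple_graph_def induced_edges_def by auto
  moreover have "acyclic_graph ?E"
  proof -
    have "is_cycle ?E xs \<Longrightarrow> is_cycle E xs" for xs
      unfolding is_cycle_def adj_def induced_edges_def by auto
    then show ?thesis using tree_acyclic unfolding acyclic_graph_def by blast
  qed
  moreover have "connected_graph ?V ?E"
  proof -
    \<comment> \<open>A walk from \<open>c\<close> that avoids \<open>r\<close> never leaves the
      branch, so its edges are induced edges. Connecting two vertices through \<open>c\<close> then
      suffices.\<close>
    have c: "(adj ?E)\<^sup>*\<^sup>* c v" if "v \<in> ?V" for v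
    proof -
      have "(adj {e \<in> E. r \<notin> e})\<^sup>*\<^sup>* c v" using that unfolding branch_def by simp
      then show ?thesis
      proof (induction rule: rtranclp_induct)
        case (step y z)
        have "y \<in> ?V" using step(1) unfolding branch_def by simp
        then have "{y, z} \<subseteq> ?V" using step(2) edge_in_branch[of "{y, z}" y] unfolding adj_def by simp
        then have "adj ?E y z" using step(2) unfolding adj_def induced_edges_def by simp
        then show ?case using step(3) by (rule rtranclp.rtrancl_into_rtrancl[rotated])
      qed simp
    qed
    have "(adj ?E)\<^sup>*\<^sup>* u v" if "u \<in> ?V" "v \<in> ?V" for u v
      using rtranclp_trans[OF rtranclp_adj_commute[OF c[OF that(1)]] c[OF that(2)]] .
    then show ?thesis using self_in_branch[of c] unfolding connected_graph_def by auto
  qed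
  ultimately show ?thesis unfolding is_tree_def by blast
qed

lemma branch_degree_le: "Defs.degree (induced_edges E S) v \<le> Defs.degree E v"
  unfolding Defs.degree_def using finite_neighbours[OF tree_simple]
  by (intro card_mono) (auto simp: induced_edges_def)

text \<open>The edge to \<open>r\<close> is lost. A child of degree at most 3 thus becomes a root of
  degree at most 2, which is what the recursion into branches requires.\<close>

lemma branch_degree_root:
  assumes "{c, r} \<in> E"
  shows "Defs.degree (induced_edges E (branch E r c)) c < Defs.degree E c"
  unfolding Defs.degree_def
proof (rule psubset_card_mono[OF finite_neighbours[OF tree_simple]])
  have "{r, c} \<in> E" using assms by (simp add: insert_commute)
  moreover have "{r, c} \<notin> induced_edges E (branch E r c)"
    using branch_subset[OF assms] unfolding induced_edges_def by auto
  ultimately show "{u. {u, c} \<in> induced_edges E (branch E r c)} \<subset> {u. {u, c} \<in> E}"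
    unfolding induced_edges_def by auto
qed

text \<open>A common vertex would give a path from \<open>c\<close> to \<open>d\<close> avoiding
  \<open>r\<close>, and \<open>r\<close> would close it to a cycle.\<close>

lemma branch_disjoint:
  assumes "{c, r} \<in> E" "{d, r} \<in> E" "c \<noteq> d"
  shows "branch E r c \<inter> branch E r d = {}"
proof (rule ccontr)
  let ?E = "{e \<in> E. r \<notin> e}"
  assume "branch E r c \<inter> branch E r d \<noteq> {}"
  then obtain v where v: "(adj ?E)\<^sup>*\<^sup>* c v" "(adj ?E)\<^sup>*\<^sup>* d v" unfolding branch_def by auto
  from rtranclp_imp_distinct_path[OF rtranclp_trans[OF v(1) rtranclp_adj_commute[OF v(2)]]] obtain xs where
    xs: "xs \<noteq> []" "hd xs = c" "last xs = d" "distinct xs" "successively (adj ?E) xs" by blast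
  have "x \<in> branch E r c" if "x \<in> set xs" for x
    using successively_imp_rtranclp[OF xs(5) that] xs(2) unfolding branch_def by simp
  then have "r \<notin> set xs" using branch_subset[OF assms(1)] by blast
  moreover have "successively (adj E) xs"
    using xs(5) by (rule successively_mono) (simp add: adj_def)
  moreover have "2 \<le> length xs"
    using xs(1-3) assms(3) by (cases xs rule: remdups_adj.cases) auto
  ultimately have "is_cycle E (r # xs)"
    using xs assms(1,2) unfolding is_cycle_iff
    by (auto simp: successively_Cons adj_def insert_commute)
  then show False using tree_acyclic unfolding acyclic_graph_def by blast
qed

lemma vertices_branches: "V = insert r (\<Union>c\<in>{c. {c, r} \<in> E}. branch E r c)"
proof
  show "insert r (\<Union>c\<in>{c. {c, r} \<in> E}. branch E r c) \<subseteq> V"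
    using r branch_subset by auto
  show "V \<subseteq> insert r (\<Union>c\<in>{c. {c, r} \<in> E}. branch E r c)"
  proof
    fix v assume "v \<in> V"
    then have "(adj E)\<^sup>*\<^sup>* r v" using tree r unfolding is_tree_def connected_graph_def by blast
    then show "v \<in> insert r (\<Union>c\<in>{c. {c, r} \<in> E}. branch E r c)"
    proof (induction rule: rtranclp_induct)
      case (step y z)
      have yz: "{y, z} \<in> E" using step(2) unfolding adj_def .
      consider "z = r" | "y = r" | "z \<noteq> r" "y \<noteq> r" by blast
      then show ?case
      proof cases
        case 2
        then show ?thesis using yz self_in_branch[of z] by (auto simp: insert_commute)
      next
        case 3
        then obtain c where "{c, r} \<in> E" "y \<in> branch E r c" using step(3) by auto
        then show ?thesis using edge_in_branch[OF yz, of y c] 3 by auto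
      qed simp
    qed simp
  qed
qed

lemma edges_branches:
  "E = (\<Union>c\<in>{c. {c, r} \<in> E}. induced_edges E (branch E r c)) \<union> (\<lambda>c. {r, c}) ` {c. {c, r} \<in> E}"
    (is "_ = ?R")
proof
  show "?R \<subseteq> E" unfolding induced_edges_def by (auto simp: insert_commute)
  show "E \<subseteq> ?R"
  proof
    fix e assume e: "e \<in> E"
    show "e \<in> ?R"
    proof (cases "r \<in> e")
      case True
      then obtain c where "e = {c, r}" using edge_doubleton[OF tree_simple e] by metis
      then have "e = {r, c}" "c \<in> {c. {c, r} \<in> E}" using e by auto
      then show ?thesis by blast
    next
      case False
      have "card e = 2" "e \<subseteq> V" using e tree_simple unfolding simple_graph_def by auto
      then obtain u where u: "u \<in> e" "u \<in> V" "u \<noteq> r" using False by (auto simp: card_2_iff)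
      have "u \<in> insert r (\<Union>c\<in>{c. {c, r} \<in> E}. branch E r c)"
        using u(2) by (subst (asm) vertices_branches)
      then obtain c where c: "{c, r} \<in> E" "u \<in> branch E r c" using u(3) by auto
      have "e \<in> induced_edges E (branch E r c)"
        using edge_in_branch[OF e False u(1) c(2)] e unfolding induced_edges_def by simp
      then show ?thesis using c(1) by blast
    qed
  qed
qed

end

lemma card_le_2_cases:
  assumes "finite S" "card S \<le> 2"
  obtains "S = {}" | c where "S = {c}" | c d where "c \<noteq> d" "S = {c, d}"
proof -
  consider "card S = 0" | "card S = 1" | "card S = 2" using assms(2) by linarith
  then show ?thesis
  proof cases
    case 1
    then show ?thesis using that(1) assms(1) by simp
  next
    case 2
    then show ?thesis using that(2) card_1_singletonE by blast
  next
    case 3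
    then show ?thesis using that(3) unfolding card_2_iff by blast
  qed
qed

text \<open>Induction on the number of vertices, recursing into the at most two branches at the
  root. The root bound 2 is stronger than the bound 3 elsewhere; in a branch the lost edge to the
  parent restores it.\<close>

lemma subcubic_tree_binary:
  assumes "is_tree V E" "r \<in> V" "Defs.degree E r \<le> 2" "\<And>v. v \<in> V \<Longrightarrow> Defs.degree E v \<le> 3"
  shows "\<exists>t. distinct_tree t \<and> set_tree t = V \<and> tree_edges t = E \<and> root_set t = {r}"
  using assms
proof (induction "card V" arbitrary: V E r rule: less_induct)
  case less
  note T = less.prems(1,2)
  let ?B = "branch E r" and ?I = "\<lambda>c. induced_edges E (branch E r c)"
  define N where "N = {c. {c, r} \<in> E}"
  have sg: "simple_graph V E" using T(1) unfolding is_tree_def by simp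
  have "\<exists>t. distinct_tree t \<and> set_tree t = ?B c \<and> tree_edges t = ?I c \<and> root_set t = {c}"
    if "c \<in> N" for c
  proof -
    have c: "{c, r} \<in> E" using that unfolding N_def by simp
    note sub = branch_subset[OF T c]
    have "c \<in> V" using edge_ends[OF sg c] by simp
    show ?thesis
    proof (rule less.hyps)
      have "?B c \<subset> V" using sub T(2) by auto
      then show "card (?B c) < card V"
        using sg unfolding simple_graph_def by (intro psubset_card_mono) auto
      show "is_tree (?B c) (?I c)" by (rule branch_is_tree[OF T c])
      show "c \<in> ?B c" by (rule self_in_branch[OF T])
      show "Defs.degree (?I c) c \<le> 2"
        using branch_degree_root[OF T c] less.prems(4)[OF \<open>c \<in> V\<close>] by linarith
      show "Defs.degree (?I c) v \<le> 3" if "v \<in> ?B c" for v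
        using branch_degree_le[OF T, of "?B c" v] less.prems(4)[of v] that sub by fastforce
    qed
  qed
  then obtain f where f: "distinct_tree (f c)" "set_tree (f c) = ?B c" "tree_edges (f c) = ?I c"
      "root_set (f c) = {c}" if "c \<in> N" for c
    by metis
  have V: "V = insert r (\<Union>c\<in>N. ?B c)" and E: "E = (\<Union>c\<in>N. ?I c) \<union> (\<lambda>c. {r, c}) ` N"
    unfolding N_def by (rule vertices_branches[OF T], rule edges_branches[OF T])
  have rB: "r \<notin> ?B c" if "c \<in> N" for c
    using branch_subset[OF T, of c] that unfolding N_def by auto
  have "finite N" "card N \<le> 2"
    using finite_neighbours[OF sg] less.prems(3) unfolding N_def Defs.degree_def by auto
  then show ?case
  proof (cases rule: card_le_2_cases)
    case 1
    then show ?thesis using V E by (intro exI[of _ "Node Leaf r Leaf"]) simp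
  next
    case (2 c)
    then show ?thesis using V E f[of c] rB[of c] by (intro exI[of _ "Node (f c) r Leaf"]) auto
  next
    case (3 c d)
    then have "?B c \<inter> ?B d = {}"
      using branch_disjoint[OF T, of c d] unfolding N_def by auto
    then show ?thesis using V E f[of c] f[of d] rB[of c] rB[of d] 3
      by (intro exI[of _ "Node (f c) r (f d)"]) auto
  qed
qed

section \<open>Generating polynomials of dissociation sets\<close>

definition nbrs :: "'a tree \<Rightarrow> 'a set \<Rightarrow> 'a \<Rightarrow> 'a set" where
  "nbrs t F v = {u \<in> F. {u, v} \<in> tree_edges t}"

definition diss :: "'a tree \<Rightarrow> 'a set set" where
  "diss t = {F. dissociation_set (set_tree t) (tree_edges t) F}"

text \<open>Phrased with \<open>root_set\<close> so that the empty tree gets the neutral values: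
  \<open>{{}}\<close> here and no set at all in \<open>diss_iso\<close>. A missing child then obeys
  the same recurrences as a present one.\<close>

definition diss_out :: "'a tree \<Rightarrow> 'a set set" where
  "diss_out t = {F \<in> diss t. root_set t \<inter> F = {}}"

definition diss_iso :: "'a tree \<Rightarrow> 'a set set" where
  "diss_iso t = {F \<in> diss t. root_set t \<inter> F \<noteq> {} \<and> (\<forall>b\<in>root_set t. nbrs t F b = {})}"

lemma diss_iff: "F \<in> diss t \<longleftrightarrow> F \<subseteq> set_tree t \<and> (\<forall>v\<in>F. card (nbrs t F v) \<le> 1)"
  unfolding diss_def dissociation_set_def nbrs_def by simp

lemma diss_subset: "F \<in> diss t \<Longrightarrow> F \<subseteq> set_tree t"
  by (simp add: diss_iff)

lemma finite_diss: "finite (diss t)"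
  by (rule finite_subset[of _ "Pow (set_tree t)"]) (auto dest: diss_subset)

lemma diss_out_subset: "diss_out t \<subseteq> diss t" and diss_iso_subset: "diss_iso t \<subseteq> diss t"
  unfolding diss_out_def diss_iso_def by auto

lemma diss_Leaf: "diss Leaf = {{}}" "diss_out Leaf = {{}}" "diss_iso Leaf = {}"
  by (auto simp: diss_iff diss_out_def diss_iso_def)

text \<open>With the parent \<open>a\<close> of the root chosen as well, the root must not have been matched.\<close>
lemma diss_below_chosen:
  assumes "A \<subseteq> set_tree t" "a \<notin> set_tree t"
  shows "(\<forall>v\<in>A. card (nbrs t A v \<union> (if v \<in> root_set t then {a} else {})) \<le> 1)
     \<longleftrightarrow> A \<in> diss_out t \<union> diss_iso t"
proof -
  have fin: "finite (nbrs t A v)" for v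
    using assms(1) finite_subset unfolding nbrs_def by (auto simp: finite_subset[OF assms(1)])
  have na: "a \<notin> nbrs t A v" for v using assms unfolding nbrs_def by auto
  have c: "card (nbrs t A v \<union> {a}) \<le> 1 \<longleftrightarrow> nbrs t A v = {}" for v
    using fin[of v] na[of v] by simp
  show ?thesis
  proof (cases "root_set t \<inter> A = {}")
    case True
    then have "v \<notin> root_set t" if "v \<in> A" for v using that by auto
    then show ?thesis using True assms(1) by (simp add: diss_out_def diss_iso_def diss_iff)
  next
    case False
    then obtain b where b: "root_set t = {b}" "b \<in> A" using root_set_cases[of t] by auto
    have "(\<forall>v\<in>A. card (nbrs t A v \<union> (if v \<in> root_set t then {a} else {})) \<le> 1) \<longleftrightarrow>
        nbrs t A b = {} \<and> (\<forall>v\<in>A. card (nbrs t A v) \<le> 1)"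
    proof -
      have "(\<forall>v\<in>A. card (nbrs t A v \<union> (if v \<in> root_set t then {a} else {})) \<le> 1) \<longleftrightarrow>
          card (nbrs t A b \<union> {a}) \<le> 1 \<and> (\<forall>v\<in>A - {b}. card (nbrs t A v) \<le> 1)"
        using b by (auto simp del: Un_insert_right)
      then show ?thesis unfolding c using b by (auto simp: card.empty)
    qed
    then show ?thesis using b assms(1) by (auto simp: diss_out_def diss_iso_def diss_iff)
  qed
qed

section \<open>Dissociation sets of a node in terms of its subtrees\<close>

definition join :: "'a set set \<Rightarrow> 'a set set \<Rightarrow> 'a set set" where
  "join X Y = (\<lambda>(A, B). A \<union> B) ` (X \<times> Y)"

context
  fixes l r :: "'a tree" and a :: 'a
  assumes dist: "distinct_tree (Node l a r)"
begin

lemma edges_Node_iff: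
  "u \<in> set_tree l \<Longrightarrow> v \<in> set_tree l \<Longrightarrow> {u, v} \<in> tree_edges (Node l a r) \<longleftrightarrow> {u, v} \<in> tree_edges l"
  "u \<in> set_tree r \<Longrightarrow> v \<in> set_tree r \<Longrightarrow> {u, v} \<in> tree_edges (Node l a r) \<longleftrightarrow> {u, v} \<in> tree_edges r"
  "u \<in> set_tree l \<Longrightarrow> v \<in> set_tree r \<Longrightarrow> {u, v} \<notin> tree_edges (Node l a r)"
  "u \<in> set_tree r \<Longrightarrow> v \<in> set_tree l \<Longrightarrow> {u, v} \<notin> tree_edges (Node l a r)"
  "{a, v} \<in> tree_edges (Node l a r) \<longleftrightarrow> v \<in> root_set l \<union> root_set r"
  "{v, a} \<in> tree_edges (Node l a r) \<longleftrightarrow> v \<in> root_set l \<union> root_set r"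
proof -
  have E: "{x, y} \<in> tree_edges (Node l a r) \<longleftrightarrow> {x, y} \<in> tree_edges l \<or> {x, y} \<in> tree_edges r
      \<or> x = a \<and> y \<in> root_set l \<union> root_set r \<or> y = a \<and> x \<in> root_set l \<union> root_set r" for x y
    by (auto simp: doubleton_eq_iff)
  have el: "x \<in> set_tree l \<and> y \<in> set_tree l" if "{x, y} \<in> tree_edges l" for x y
    using tree_edges_subset[OF that] by simp
  have er: "x \<in> set_tree r \<and> y \<in> set_tree r" if "{x, y} \<in> tree_edges r" for x y
    using tree_edges_subset[OF that] by simp
  have d: "x \<notin> set_tree l \<or> x \<notin> set_tree r" "a \<notin> set_tree l" "a \<notin> set_tree r" for x
    using dist by auto
  show "u \<in> set_tree l \<Longrightarrow> v \<in> set_tree l \<Longrightarrow> {u, v} \<in> tree_edges (Node l a r) \<longleftrightarrow> {u, v} \<in> tree_edges l"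
    "u \<in> set_tree r \<Longrightarrow> v \<in> set_tree r \<Longrightarrow> {u, v} \<in> tree_edges (Node l a r) \<longleftrightarrow> {u, v} \<in> tree_edges r"
    "u \<in> set_tree l \<Longrightarrow> v \<in> set_tree r \<Longrightarrow> {u, v} \<notin> tree_edges (Node l a r)"
    "u \<in> set_tree r \<Longrightarrow> v \<in> set_tree l \<Longrightarrow> {u, v} \<notin> tree_edges (Node l a r)"
    "{a, v} \<in> tree_edges (Node l a r) \<longleftrightarrow> v \<in> root_set l \<union> root_set r"
    "{v, a} \<in> tree_edges (Node l a r) \<longleftrightarrow> v \<in> root_set l \<union> root_set r"
    unfolding E using el er d by metis+
qed

lemma nbrs_Node:
  assumes "A \<subseteq> set_tree l" "B \<subseteq> set_tree r"
  shows "v \<in> set_tree l \<Longrightarrow> nbrs (Node l a r) (A \<union> B) v = nbrs l A v"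
    "v \<in> set_tree r \<Longrightarrow> nbrs (Node l a r) (A \<union> B) v = nbrs r B v"
    "v \<in> set_tree l \<Longrightarrow> nbrs (Node l a r) (insert a (A \<union> B)) v
       = nbrs l A v \<union> (if v \<in> root_set l then {a} else {})"
    "v \<in> set_tree r \<Longrightarrow> nbrs (Node l a r) (insert a (A \<union> B)) v
       = nbrs r B v \<union> (if v \<in> root_set r then {a} else {})"
    "nbrs (Node l a r) (insert a (A \<union> B)) a = (A \<inter> root_set l) \<union> (B \<inter> root_set r)"
proof -
  have l: "u \<in> set_tree l" if "u \<in> A" for u using that assms by auto
  have r: "u \<in> set_tree r" if "u \<in> B" for u using that assms by auto
  have d: "x \<notin> set_tree l \<or> x \<notin> set_tree r" "a \<notin> set_tree l" "a \<notin> set_tree r" for x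
    using dist by auto
  have rl: "x \<in> root_set l \<Longrightarrow> x \<in> set_tree l" "x \<in> root_set r \<Longrightarrow> x \<in> set_tree r" for x
    using root_set_subset by fastforce+
  note E = edges_Node_iff
  show "v \<in> set_tree l \<Longrightarrow> nbrs (Node l a r) (A \<union> B) v = nbrs l A v"
    unfolding nbrs_def using l r E(1,4) by blast
  show "v \<in> set_tree r \<Longrightarrow> nbrs (Node l a r) (A \<union> B) v = nbrs r B v"
    unfolding nbrs_def using l r E(2,3) by blast
  show "nbrs (Node l a r) (insert a (A \<union> B)) v
       = nbrs l A v \<union> (if v \<in> root_set l then {a} else {})" if "v \<in> set_tree l"
  proof -
    have "v \<notin> root_set r" using that d rl by blast
    then show ?thesis
      unfolding nbrs_def using that l r E(1,4) E(5)[of v] by (auto simp del: tree_edges.simps)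
  qed
  show "nbrs (Node l a r) (insert a (A \<union> B)) v
       = nbrs r B v \<union> (if v \<in> root_set r then {a} else {})" if "v \<in> set_tree r"
  proof -
    have "v \<notin> root_set l" using that d rl by blast
    then show ?thesis
      unfolding nbrs_def using that l r E(2,3) E(5)[of v] by (auto simp del: tree_edges.simps)
  qed
  show "nbrs (Node l a r) (insert a (A \<union> B)) a = (A \<inter> root_set l) \<union> (B \<inter> root_set r)"
  proof -
    have "x \<in> A \<Longrightarrow> x \<notin> root_set r" "x \<in> B \<Longrightarrow> x \<notin> root_set l" "a \<notin> root_set l \<union> root_set r" for x
      using l r d rl by blast+
    then show ?thesis
      unfolding nbrs_def using E(6) by (auto simp del: tree_edges.simps)
  qed
qed

lemma Un_mem_diss_Node:
  assumes "A \<subseteq> set_tree l" "B \<subseteq> set_tree r"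
  shows "A \<union> B \<in> diss (Node l a r) \<longleftrightarrow> A \<in> diss l \<and> B \<in> diss r"
proof -
  have "(\<forall>v\<in>A. card (nbrs (Node l a r) (A \<union> B) v) \<le> 1) \<longleftrightarrow> (\<forall>v\<in>A. card (nbrs l A v) \<le> 1)"
    using nbrs_Node(1)[OF assms] assms by (intro ball_cong) auto
  moreover have "(\<forall>v\<in>B. card (nbrs (Node l a r) (A \<union> B) v) \<le> 1) \<longleftrightarrow> (\<forall>v\<in>B. card (nbrs r B v) \<le> 1)"
    using nbrs_Node(2)[OF assms] assms by (intro ball_cong) auto
  ultimately show ?thesis using assms unfolding diss_iff by auto
qed

text \<open>A chosen root of a subtree gains the neighbour \<open>a\<close>, so it must have been
  isolated. Since \<open>a\<close> tolerates only one chosen neighbour, this can happen on one side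
  at most.\<close>

lemma insert_mem_diss_Node:
  assumes "A \<subseteq> set_tree l" "B \<subseteq> set_tree r"
  shows "insert a (A \<union> B) \<in> diss (Node l a r) \<longleftrightarrow>
    A \<in> diss_out l \<and> B \<in> diss_out r \<or> A \<in> diss_iso l \<and> B \<in> diss_out r \<or> A \<in> diss_out l \<and> B \<in> diss_iso r"
proof -
  let ?N = "nbrs (Node l a r) (insert a (A \<union> B))"
  have "(\<forall>v\<in>A. card (?N v) \<le> 1) \<longleftrightarrow> A \<in> diss_out l \<union> diss_iso l"
    using nbrs_Node(3)[OF assms] assms dist
    by (subst diss_below_chosen[symmetric, of _ _ a]) (auto intro!: ball_cong simp del: Un_insert_right)
  moreover have "(\<forall>v\<in>B. card (?N v) \<le> 1) \<longleftrightarrow> B \<in> diss_out r \<union> diss_iso r"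
    using nbrs_Node(4)[OF assms] assms dist
    by (subst diss_below_chosen[symmetric, of _ _ a]) (auto intro!: ball_cong simp del: Un_insert_right)
  \<comment> \<open>The chosen neighbours of \<open>a\<close> are the chosen roots of the two
    subtrees, and these roots are distinct.\<close>
  moreover have "card (?N a) \<le> 1 \<longleftrightarrow> A \<inter> root_set l = {} \<or> B \<inter> root_set r = {}"
  proof -
    have "b \<notin> root_set r" if "b \<in> root_set l" for b
      using that dist root_set_subset[of l] root_set_subset[of r] by auto
    then show ?thesis
      unfolding nbrs_Node(5)[OF assms] using root_set_cases[of l] root_set_cases[of r]
      by (elim disjE exE) (auto simp: Int_insert_right card_insert_if)
  qed
  moreover have "(\<forall>v\<in>insert a (A \<union> B). card (?N v) \<le> 1) \<longleftrightarrow>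
      (\<forall>v\<in>A. card (?N v) \<le> 1) \<and> (\<forall>v\<in>B. card (?N v) \<le> 1) \<and> card (?N a) \<le> 1"
    by blast
  moreover have "insert a (A \<union> B) \<subseteq> set_tree (Node l a r)" using assms by auto
  moreover have "X \<inter> root_set t = {} \<longleftrightarrow> X \<in> diss_out t" if "X \<in> diss_out t \<union> diss_iso t" for X and t :: "'a tree"
    using that by (auto simp: diss_out_def diss_iso_def)
  moreover have "X \<notin> diss_out t \<or> X \<notin> diss_iso t" for X and t :: "'a tree"
    by (auto simp: diss_out_def diss_iso_def)
  ultimately show ?thesis
    unfolding diss_iff[of "insert a (A \<union> B)"] by blast
qed

lemma subset_Node_cases:
  assumes "F \<subseteq> set_tree (Node l a r)"
  obtains A B where "A \<subseteq> set_tree l" "B \<subseteq> set_tree r" "F = A \<union> B"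
  | A B where "A \<subseteq> set_tree l" "B \<subseteq> set_tree r" "F = insert a (A \<union> B)"
proof (cases "a \<in> F")
  case True
  then have "F = insert a ((F \<inter> set_tree l) \<union> (F \<inter> set_tree r))" using assms by auto
  then show ?thesis using that(2)[of "F \<inter> set_tree l" "F \<inter> set_tree r"] by blast
next
  case False
  then have "F = (F \<inter> set_tree l) \<union> (F \<inter> set_tree r)" using assms by auto
  then show ?thesis using that(1)[of "F \<inter> set_tree l" "F \<inter> set_tree r"] by blast
qed

lemma diss_out_Node: "diss_out (Node l a r) = join (diss l) (diss r)"
proof (intro equalityI subsetI)
  fix F assume F: "F \<in> diss_out (Node l a r)"
  then have "F \<subseteq> set_tree (Node l a r)" using diss_out_subset diss_subset by blast
  then show "F \<in> join (diss l) (diss r)"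
  proof (cases rule: subset_Node_cases)
    case (1 A B)
    then have "A \<in> diss l" "B \<in> diss r" using F Un_mem_diss_Node unfolding diss_out_def by auto
    then show ?thesis using 1 unfolding join_def by auto
  next
    case (2 A B)
    then show ?thesis using F unfolding diss_out_def by auto
  qed
next
  fix F assume "F \<in> join (diss l) (diss r)"
  then obtain A B where "F = A \<union> B" "A \<in> diss l" "B \<in> diss r" unfolding join_def by auto
  then show "F \<in> diss_out (Node l a r)"
    using Un_mem_diss_Node[of A B] diss_subset[of A l] diss_subset[of B r] dist
    unfolding diss_out_def by auto
qed

lemma diss_iso_Node: "diss_iso (Node l a r) = insert a ` join (diss_out l) (diss_out r)"
proof (intro equalityI subsetI)
  fix F assume F: "F \<in> diss_iso (Node l a r)"
  then have "F \<subseteq> set_tree (Node l a r)" using diss_iso_subset diss_subset by blast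
  then show "F \<in> insert a ` join (diss_out l) (diss_out r)"
  proof (cases rule: subset_Node_cases)
    case (1 A B)
    then show ?thesis using F dist unfolding diss_iso_def by auto
  next
    case (2 A B)
    have "A \<inter> root_set l = {}" "B \<inter> root_set r = {}"
      using F nbrs_Node(5)[OF 2(1,2)] 2(3) unfolding diss_iso_def by auto
    then have "A \<in> diss_out l" "B \<in> diss_out r"
      using F insert_mem_diss_Node[OF 2(1,2)] 2(3) unfolding diss_iso_def by auto
    then show ?thesis using 2 unfolding join_def by auto
  qed
next
  fix F assume "F \<in> insert a ` join (diss_out l) (diss_out r)"
  then obtain A B where F: "F = insert a (A \<union> B)" "A \<in> diss_out l" "B \<in> diss_out r"
    unfolding join_def by auto
  then have s: "A \<subseteq> set_tree l" "B \<subseteq> set_tree r"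
    using diss_out_subset diss_subset by blast+
  then show "F \<in> diss_iso (Node l a r)"
    using F insert_mem_diss_Node[OF s] nbrs_Node(5)[OF s] unfolding diss_iso_def
    by (auto simp: diss_out_def)
qed

lemma diss_Node:
  "diss (Node l a r) = join (diss l) (diss r) \<union> insert a `
     (join (diss_out l) (diss_out r) \<union> (join (diss_iso l) (diss_out r) \<union> join (diss_out l) (diss_iso r)))"
proof (intro equalityI subsetI)
  fix F assume F: "F \<in> diss (Node l a r)"
  then have "F \<subseteq> set_tree (Node l a r)" using diss_subset by blast
  then show "F \<in> join (diss l) (diss r) \<union> insert a `
     (join (diss_out l) (diss_out r) \<union> (join (diss_iso l) (diss_out r) \<union> join (diss_out l) (diss_iso r)))"
  proof (cases rule: subset_Node_cases)
    case (1 A B)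
    then show ?thesis using F Un_mem_diss_Node unfolding join_def by auto
  next
    case (2 A B)
    then show ?thesis using F insert_mem_diss_Node[OF 2(1,2)] unfolding join_def by auto
  qed
next
  have s: "A \<subseteq> set_tree t" if "A \<in> diss t \<or> A \<in> diss_out t \<or> A \<in> diss_iso t" for A and t :: "'a tree"
    using that diss_subset diss_out_subset diss_iso_subset by blast
  fix F assume "F \<in> join (diss l) (diss r) \<union> insert a `
     (join (diss_out l) (diss_out r) \<union> (join (diss_iso l) (diss_out r) \<union> join (diss_out l) (diss_iso r)))"
  then consider A B where "F = A \<union> B" "A \<in> diss l" "B \<in> diss r"
    | A B where "F = insert a (A \<union> B)" "A \<in> diss_out l" "B \<in> diss_out r"
    | A B where "F = insert a (A \<union> B)" "A \<in> diss_iso l" "B \<in> diss_out r"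
    | A B where "F = insert a (A \<union> B)" "A \<in> diss_out l" "B \<in> diss_iso r"
    unfolding join_def by auto
  then show "F \<in> diss (Node l a r)"
  proof cases
    case 1
    then show ?thesis using Un_mem_diss_Node[of A B] s by blast
  next
    case 2
    then show ?thesis using insert_mem_diss_Node[of A B] s by blast
  next
    case 3
    then show ?thesis using insert_mem_diss_Node[of A B] s by blast
  next
    case 4
    then show ?thesis using insert_mem_diss_Node[of A B] s by blast
  qed
qed

end

section \<open>Recurrences for the generating polynomials\<close>

definition gf :: "'a set set \<Rightarrow> real poly" where
  "gf X = (\<Sum>F\<in>X. monom 1 (card F))"

lemma coeff_gf: "finite X \<Longrightarrow> coeff (gf X) k = card {F \<in> X. card F = k}"
  unfolding gf_def by (simp add: coeff_sum sum.If_cases Int_def)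

lemma Un_eq_Un_disjointD:
  assumes "A \<subseteq> S" "B \<subseteq> T" "A' \<subseteq> S" "B' \<subseteq> T" "S \<inter> T = {}" "A \<union> B = A' \<union> B'"
  shows "A = A' \<and> B = B'"
proof -
  have "A = (A \<union> B) \<inter> S" "B = (A \<union> B) \<inter> T" "A' = (A' \<union> B') \<inter> S" "B' = (A' \<union> B') \<inter> T"
    using assms(1-5) by auto
  then show ?thesis using assms(6) by metis
qed

text \<open>On disjoint vertex sets a union determines its two parts and cardinalities add.\<close>

lemma gf_join:
  assumes "X \<subseteq> Pow S" "Y \<subseteq> Pow T" "S \<inter> T = {}" "finite S" "finite T"
  shows "gf (join X Y) = gf X * gf Y"
proof -
  have "inj_on (\<lambda>(A, B). A \<union> B) (X \<times> Y)"
  proof (rule inj_onI, clarify)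
    fix A B A' B' assume *: "A \<in> X" "B \<in> Y" "A' \<in> X" "B' \<in> Y" "A \<union> B = A' \<union> B'"
    then have "A \<subseteq> S" "B \<subseteq> T" "A' \<subseteq> S" "B' \<subseteq> T" using assms(1,2) by auto
    then show "A = A' \<and> B = B'" using Un_eq_Un_disjointD *(5) assms(3) by metis
  qed
  then have "gf (join X Y) = (\<Sum>(A, B)\<in>X \<times> Y. monom 1 (card (A \<union> B)))"
    unfolding gf_def join_def by (simp add: sum.reindex case_prod_unfold)
  also have "\<dots> = (\<Sum>(A, B)\<in>X \<times> Y. monom 1 (card A) * monom 1 (card B))"
  proof (intro sum.cong refl, clarify)
    fix A B assume "A \<in> X" "B \<in> Y"
    then have "A \<subseteq> S" "B \<subseteq> T" using assms(1,2) by auto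
    then have "A \<inter> B = {}" "finite A" "finite B"
      using assms(3-5) finite_subset by auto
    then show "monom (1::real) (card (A \<union> B)) = monom 1 (card A) * monom 1 (card B)"
      by (simp add: card_Un_disjoint mult_monom)
  qed
  also have "\<dots> = gf X * gf Y"
    unfolding gf_def by (simp add: sum_product sum.cartesian_product)
  finally show ?thesis .
qed

text \<open>One more element multiplies by the variable, which is \<open>pCons 0\<close>.\<close>

lemma gf_insert_image:
  assumes "X \<subseteq> Pow S" "finite S" "a \<notin> S"
  shows "gf (insert a ` X) = pCons 0 (gf X)"
proof -
  have na: "a \<notin> A" "finite A" if "A \<in> X" for A
    using that assms finite_subset[of A S] by auto
  have "inj_on (insert a) X"
    using na(1) by (intro inj_onI) (metis insert_ident)
  then have "gf (insert a ` X) = (\<Sum>A\<in>X. monom 1 (card (insert a A)))"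
    unfolding gf_def by (simp add: sum.reindex)
  also have "\<dots> = (\<Sum>A\<in>X. pCons 0 (monom 1 (card A)))"
    using na by (intro sum.cong) (auto simp: monom_Suc)
  also have "\<dots> = pCons 0 (gf X)"
    unfolding gf_def by (induction X rule: infinite_finite_induct) auto
  finally show ?thesis .
qed

lemma gf_Un: "finite X \<Longrightarrow> finite Y \<Longrightarrow> X \<inter> Y = {} \<Longrightarrow> gf (X \<union> Y) = gf X + gf Y"
  unfolding gf_def by (rule sum.union_disjoint)

text \<open>The unions in \<open>diss_Node\<close> are disjoint, so they turn into sums. The term
  \<open>pCons 0 cross\<close> counts the sets in which the root is matched with the root of a
  subtree, split according to which one.\<close>

lemma gf_Node:
  assumes "distinct_tree (Node l a r)"
  defines "cross \<equiv> gf (diss_iso l) * gf (diss_out r) + gf (diss_out l) * gf (diss_iso r)"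
  shows "gf (diss_out (Node l a r)) = gf (diss l) * gf (diss r)"
    "gf (diss_iso (Node l a r)) = pCons 0 (gf (diss_out l) * gf (diss_out r))"
    "gf (diss (Node l a r)) = gf (diss l) * gf (diss r)
       + pCons 0 (gf (diss_out l) * gf (diss_out r) + cross)"
proof -
  let ?L = "set_tree l" and ?R = "set_tree r"
  have sub: "diss t \<subseteq> Pow (set_tree t)" "diss_out t \<subseteq> Pow (set_tree t)" "diss_iso t \<subseteq> Pow (set_tree t)"
    for t :: "'a tree"
    using diss_subset diss_out_subset diss_iso_subset by blast+
  have d: "?L \<inter> ?R = {}" "a \<notin> ?L \<union> ?R" using assms(1) by auto
  have j: "gf (join X Y) = gf X * gf Y" if "X \<subseteq> Pow ?L" "Y \<subseteq> Pow ?R" for X Y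
    by (rule gf_join[OF that d(1)]) auto
  have jsub: "join X Y \<subseteq> Pow (?L \<union> ?R)" if "X \<subseteq> Pow ?L" "Y \<subseteq> Pow ?R" for X Y
    using that unfolding join_def by fastforce
  have jfin: "finite (join X Y)" if "X \<subseteq> Pow ?L" "Y \<subseteq> Pow ?R" for X Y
    using jsub[OF that] by (rule finite_subset) simp
  \<comment> \<open>Since a union splits uniquely into its parts, disjointness on one side
    suffices.\<close>
  have jdis: "join X Y \<inter> join X' Y' = {}"
    if "X \<subseteq> Pow ?L" "Y \<subseteq> Pow ?R" "X' \<subseteq> Pow ?L" "Y' \<subseteq> Pow ?R" "X \<inter> X' = {} \<or> Y \<inter> Y' = {}" for X Y X' Y'
  proof -
    have "A = A' \<and> B = B'" if "A \<in> X" "B \<in> Y" "A' \<in> X'" "B' \<in> Y'" "A \<union> B = A' \<union> B'" for A B A' B'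
    proof (rule Un_eq_Un_disjointD[OF _ _ _ _ d(1) that(5)])
      show "A \<subseteq> ?L" "B \<subseteq> ?R" "A' \<subseteq> ?L" "B' \<subseteq> ?R"
        using that(1-4) \<open>X \<subseteq> Pow ?L\<close> \<open>Y \<subseteq> Pow ?R\<close> \<open>X' \<subseteq> Pow ?L\<close> \<open>Y' \<subseteq> Pow ?R\<close> by auto
    qed
    then show ?thesis using that(5) unfolding join_def by fast
  qed
  show "gf (diss_out (Node l a r)) = gf (diss l) * gf (diss r)"
    unfolding diss_out_Node[OF assms(1)] by (rule j) (rule sub)+
  show "gf (diss_iso (Node l a r)) = pCons 0 (gf (diss_out l) * gf (diss_out r))"
    unfolding diss_iso_Node[OF assms(1)] j[OF sub(2) sub(2), symmetric]
    by (rule gf_insert_image[OF jsub[OF sub(2) sub(2)]]) (use d in auto)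
  let ?X = "join (diss_out l) (diss_out r)" and ?Y = "join (diss_iso l) (diss_out r)"
    and ?Z = "join (diss_out l) (diss_iso r)"
  have oi: "diss_out t \<inter> diss_iso t = {}" for t :: "'a tree"
    unfolding diss_out_def diss_iso_def by auto
  have YZ: "?Y \<inter> ?Z = {}" "?X \<inter> (?Y \<union> ?Z) = {}"
    using jdis[OF sub(3) sub(2) sub(2) sub(3)] jdis[OF sub(2) sub(2) sub(3) sub(2)]
      jdis[OF sub(2) sub(2) sub(2) sub(3)] oi by (simp_all add: Int_Un_distrib Int_commute)
  have fin: "finite ?X" "finite ?Y" "finite ?Z"
    by (intro jfin sub)+
  have "gf (?X \<union> (?Y \<union> ?Z)) = gf ?X + (gf ?Y + gf ?Z)"
    using fin YZ by (simp add: gf_Un)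
  also have "\<dots> = gf (diss_out l) * gf (diss_out r) + cross"
    unfolding cross_def by (simp add: j sub)
  finally have g: "gf (?X \<union> (?Y \<union> ?Z)) = gf (diss_out l) * gf (diss_out r) + cross" .
  have s: "?X \<union> (?Y \<union> ?Z) \<subseteq> Pow (?L \<union> ?R)"
    by (intro Un_least jsub sub)
  have "join (diss l) (diss r) \<inter> insert a ` (?X \<union> (?Y \<union> ?Z)) = {}"
    using jsub[OF sub(1) sub(1)] d(2) by fastforce
  then have "gf (diss (Node l a r)) = gf (join (diss l) (diss r)) + gf (insert a ` (?X \<union> (?Y \<union> ?Z)))"
    unfolding diss_Node[OF assms(1)] using fin by (intro gf_Un jfin sub finite_imageI finite_UnI)
  also have "gf (insert a ` (?X \<union> (?Y \<union> ?Z))) = pCons 0 (gf (?X \<union> (?Y \<union> ?Z)))"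
    by (rule gf_insert_image[OF s]) (use d in auto)
  finally show "gf (diss (Node l a r)) = gf (diss l) * gf (diss r)
       + pCons 0 (gf (diss_out l) * gf (diss_out r) + cross)"
    unfolding g by (simp add: j sub)
qed

section \<open>Invariant regions\<close>

text \<open>The value of \<open>1.466\<close> to the power \<open>-4\<close>.\<close>
abbreviation shrink :: real where "shrink \<equiv> 62500000000 / 288679469521"

text \<open>
  The facet directions and the bounds are an inductive invariant found by numerical fixpoint
  iteration. Most bounds have slack, but \<open>g \<le> 0.721 * 1.466\<^sup>2\<close> in \<open>coreB\<close>, \<open>u \<le> 0.721\<close>
  in \<open>coreC\<close> and \<open>v \<le> 0.721 * 1.466\<close> in \<open>coreA\<close> are tied to each other: joining a tree of
  type \<open>B\<close> with a one-edge tree and then putting two more roots on top turns its \<open>g\<close> into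
  these \<open>u\<close>, \<open>v\<close> and \<open>g\<close>, and the total factor is exactly \<open>1\<close>.
\<close>
definition coreA :: "real \<Rightarrow> real \<Rightarrow> real \<Rightarrow> bool" where
  "coreA u v g \<longleftrightarrow> 0 < u \<and> 0 < v \<and> 0 < g \<and>
     g \<le> 1398/1000 \<and> v \<le> 1056986/1000000 \<and>
     u + v \<le> 3885/1000 \<and> u + v + 2 * g \<le> 5876/1000"

definition coreB :: "real \<Rightarrow> real \<Rightarrow> real \<Rightarrow> bool" where
  "coreB u v g \<longleftrightarrow> 0 < u \<and> 0 \<le> v \<and> 0 < g \<and>
     g \<le> 1549541476/1000000000 \<and> u + g \<le> 4401/1000 \<and> u + v + g \<le> 7157/1000"

text \<open>The bound \<open>0 \<le> v\<close> is not strict because the joins of types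
  \<open>A\<close> and \<open>B\<close> among themselves produce \<open>v = 0\<close>.\<close>

definition coreC :: "real \<Rightarrow> real \<Rightarrow> real \<Rightarrow> bool" where
  "coreC u v g \<longleftrightarrow> 0 < u \<and> 0 \<le> v \<and> 0 < g \<and>
     g \<le> 1549541476/1000000000 \<and> u \<le> 721/1000 \<and> u + v \<le> 953/1000 \<and>
     u + g \<le> 2047/1000 \<and> 2 * u + v + 2 * g \<le> 4394/1000"

text \<open>
  The isolated points belong to the one-vertex tree, the one-edge tree (\<open>537289/250000\<close> is the
  square of \<open>1.466\<close>) and the empty tree. They form a cycle under joining, so any enlargement
  of a region around them would be amplified.
\<close>
definition regionA :: "real \<Rightarrow> real \<Rightarrow> real \<Rightarrow> bool" where
  "regionA u v g \<longleftrightarrow>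
     u = 733/500 \<and> v = 733/500 \<and> g = 733/500 \<or> coreA u v g"

definition regionB :: "real \<Rightarrow> real \<Rightarrow> real \<Rightarrow> bool" where
  "regionB u v g \<longleftrightarrow>
     u = 537289/250000 \<and> v = 537289/250000 \<and> g = 537289/250000 \<or> coreB u v g"

definition regionC :: "real \<Rightarrow> real \<Rightarrow> real \<Rightarrow> bool" where
  "regionC u v g \<longleftrightarrow> u = 1 \<and> v = 0 \<and> g = 1 \<or> coreC u v g"

text \<open>
  Each facet inequality of the image is a nonnegative linear combination of products of the
  inequalities of the two arguments; the products that occur were found by linear programming.
\<close>
lemma core_CC:
  assumes "coreC u v g" "coreC U V G"
  shows "coreA (733/500 * (g * G)) (733/500 * (u * U)) (733/500 * (u * U + u * V + v * U))"
proof -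
  have b: "0 < u" "0 \<le> v" "0 < g"
    "g \<le> 1549541476/1000000000" "u \<le> 721/1000" "u + v \<le> 953/1000"
    "u + g \<le> 2047/1000" "2 * u + v + 2 * g \<le> 4394/1000"
    "0 < U" "0 \<le> V" "0 < G"
    "G \<le> 1549541476/1000000000" "U \<le> 721/1000" "U + V \<le> 953/1000"
    "U + G \<le> 2047/1000" "2 * U + V + 2 * G \<le> 4394/1000"
    using assms unfolding coreC_def by simp_all
  have f0: "733/500 * (u * U + u * V + v * U) \<le> 1398/1000"
  proof -
    have "0 \<le> u * (953/1000 - U - V)"
      "0 \<le> v * (721/1000 - U)"
      "0 \<le> (721/1000 - u) * U"
      "0 \<le> (721/1000 - u) * V"
      by (intro mult_nonneg_nonneg; use b in linarith)+
    \<comment> \<open>After expansion the products of two variables are atoms, and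
      \<open>linarith\<close> finds the coefficients of the combination.\<close>
    then show ?thesis
      unfolding ring_distribs using \<open>0 < u\<close> \<open>u + v \<le> 953/1000\<close>
        \<open>U + V \<le> 953/1000\<close> by linarith
  qed
  have f1: "733/500 * (u * U) \<le> 1056986/1000000"
  proof -
    have "0 \<le> (721/1000 - u) * U"
      by (intro mult_nonneg_nonneg; use b in linarith)+
    then show ?thesis
      unfolding ring_distribs using \<open>U \<le> 721/1000\<close> by linarith
  qed
  have f2: "733/500 * (g * G) + 733/500 * (u * U) \<le> 3885/1000"
  proof -
    have "0 \<le> u * (721/1000 - U)"
      "0 \<le> g * (1549541476/1000000000 - G)"
      "0 \<le> g * (2047/1000 - U - G)"
      "0 \<le> (1549541476/1000000000 - g) * (721/1000 - U)"
      "0 \<le> (2047/1000 - u - g) * U"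
      by (intro mult_nonneg_nonneg; use b in linarith)+
    then show ?thesis
      unfolding ring_distribs using \<open>g \<le> 1549541476/1000000000\<close>
        \<open>u + g \<le> 2047/1000\<close> by linarith
  qed
  have f3: "733/500 * (g * G) + 733/500 * (u * U) + 2 *
    (733/500 * (u * U + u * V + v * U)) \<le> 5876/1000"
  proof -
    have "0 \<le> u * U"
      "0 \<le> g * (2047/1000 - U - G)"
      "0 \<le> g * (4394/1000 - 2 * U - V - 2 * G)"
      "0 \<le> (1549541476/1000000000 - g) * (721/1000 - U)"
      "0 \<le> (1549541476/1000000000 - g) * (953/1000 - U - V)"
      "0 \<le> (953/1000 - u - v) * U"
      "0 \<le> (2047/1000 - u - g) * U"
      "0 \<le> (2047/1000 - u - g) * V"
      "0 \<le> (4394/1000 - 2 * u - v - 2 * g) * U"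
      by (intro mult_nonneg_nonneg; use b in linarith)+
    then show ?thesis
      unfolding ring_distribs using \<open>U + V \<le> 953/1000\<close> by linarith
  qed
  show ?thesis
    unfolding coreA_def using b f0 f1 f2 f3
    by (simp add: add_pos_nonneg)
qed

text \<open>If one argument is an isolated point, the bilinear map is linear in the other one, so
  products of inequalities are only needed for two cores.\<close>

lemma region_CC:
  assumes "regionC u v g" "regionC U V G"
  shows "regionA (733/500 * (g * G)) (733/500 * (u * U)) (733/500 * (u * U + u * V + v * U))"
proof -
  consider "u = 1" "v = 0" "g = 1" "U = 1" "V = 0" "G = 1"
    | "u = 1" "v = 0" "g = 1" "coreC U V G"
    | "U = 1" "V = 0" "G = 1" "coreC u v g"
    | "coreC u v g" "coreC U V G"
    using assms unfolding regionC_def by blast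
  then show ?thesis
  proof cases
    case 1
    show ?thesis unfolding 1 regionA_def coreA_def by simp
  next
    case 2
    \<comment> \<open>No slack for \<open>v\<close>: 1.466 * 0.721 is exactly 1.056986. The mirrored
      case is equally tight.\<close>
    show ?thesis using 2(4) unfolding 2(1-3) regionA_def coreA_def coreC_def ring_distribs
      by (intro disjI2) (elim conjE, intro conjI; linarith)
  next
    case 3
    show ?thesis using 3(4) unfolding 3(1-3) regionA_def coreA_def coreC_def ring_distribs
      by (intro disjI2) (elim conjE, intro conjI; linarith)
  next
    case 4
    then show ?thesis unfolding regionA_def by (intro disjI2 core_CC)
  qed
qed

text \<open>The join in which all four products reach the top degree. That degree is the sum of the
  two old ones while a vertex is added, hence the factor \<open>shrink\<close>.\<close>

lemma core_BC:
  assumes "coreB u v g" "coreC U V G"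
  shows "coreC (shrink * (g * G)) (shrink * (u * U)) (shrink * (g * G + u * U + u * V + v * U))"
proof -
  have b: "0 < u" "0 \<le> v" "0 < g"
    "g \<le> 1549541476/1000000000" "u + g \<le> 4401/1000" "u + v + g \<le> 7157/1000"
    "0 < U" "0 \<le> V" "0 < G"
    "G \<le> 1549541476/1000000000" "U \<le> 721/1000" "U + V \<le> 953/1000"
    "U + G \<le> 2047/1000" "2 * U + V + 2 * G \<le> 4394/1000"
    using assms unfolding coreB_def coreC_def by simp_all
  have f0: "shrink * (g * G + u * U + u * V + v * U) \<le> 1549541476/1000000000"
  proof -
    have "0 \<le> u * (953/1000 - U - V)"
      "0 \<le> v * (721/1000 - U)"
      "0 \<le> g * (1549541476/1000000000 - G)"
      by (intro mult_nonneg_nonneg; use b in linarith)+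
    then show ?thesis
      unfolding ring_distribs using \<open>g \<le> 1549541476/1000000000\<close>
        \<open>u + g \<le> 4401/1000\<close> \<open>u + v + g \<le> 7157/1000\<close> by linarith
  qed
  have f1: "shrink * (g * G) \<le> 721/1000"
  proof -
    have "0 \<le> g * (1549541476/1000000000 - G)"
      by (intro mult_nonneg_nonneg; use b in linarith)+
    then show ?thesis
      unfolding ring_distribs using \<open>g \<le> 1549541476/1000000000\<close> by linarith
  qed
  have f2: "shrink * (g * G) + shrink * (u * U) \<le> 953/1000"
  proof -
    have "0 \<le> u * (721/1000 - U)"
      "0 \<le> g * U"
      "0 \<le> g * (2047/1000 - U - G)"
      "0 \<le> (1549541476/1000000000 - g) * (721/1000 - U)"
      "0 \<le> (4401/1000 - u - g) * U"
      by (intro mult_nonneg_nonneg; use b in linarith)+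
    then show ?thesis
      unfolding ring_distribs using \<open>g \<le> 1549541476/1000000000\<close>
        \<open>u + g \<le> 4401/1000\<close> by linarith
  qed
  have f3: "shrink * (g * G) + shrink * (g * G + u * U + u * V + v * U) \<le> 2047/1000"
  proof -
    have "0 \<le> g * U"
      "0 \<le> g * V"
      "0 \<le> g * (2047/1000 - U - G)"
      "0 \<le> (1549541476/1000000000 - g) * (721/1000 - U)"
      "0 \<le> (1549541476/1000000000 - g) * (953/1000 - U - V)"
      "0 \<le> (4401/1000 - u - g) * V"
      "0 \<le> (7157/1000 - u - v - g) * U"
      by (intro mult_nonneg_nonneg; use b in linarith)+
    then show ?thesis
      unfolding ring_distribs using \<open>g \<le> 1549541476/1000000000\<close>
        \<open>U + V \<le> 953/1000\<close> by linarith
  qed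
  have f4: "2 * (shrink * (g * G)) + shrink * (u * U) + 2 *
    (shrink * (g * G + u * U + u * V + v * U)) \<le> 4394/1000"
  proof -
    have "0 \<le> u * (721/1000 - U)"
      "0 \<le> g * U"
      "0 \<le> g * (4394/1000 - 2 * U - V - 2 * G)"
      "0 \<le> (1549541476/1000000000 - g) * (721/1000 - U)"
      "0 \<le> (1549541476/1000000000 - g) * (953/1000 - U - V)"
      "0 \<le> (4401/1000 - u - g) * V"
      "0 \<le> (4401/1000 - u - g) * (721/1000 - U)"
      "0 \<le> (7157/1000 - u - v - g) * U"
      by (intro mult_nonneg_nonneg; use b in linarith)+
    then show ?thesis
      unfolding ring_distribs using \<open>g \<le> 1549541476/1000000000\<close>
        \<open>u + g \<le> 4401/1000\<close> \<open>U + V \<le> 953/1000\<close> by linarith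
  qed
  show ?thesis
    unfolding coreC_def using b f0 f1 f2 f3 f4
    by (simp add: add_pos_nonneg)
qed

lemma region_BC:
  assumes "regionB u v g" "regionC U V G"
  shows "regionC (shrink * (g * G)) (shrink * (u * U)) (shrink * (g * G + u * U + u * V + v * U))"
proof -
  consider "u = 537289/250000" "v = 537289/250000" "g = 537289/250000" "U = 1" "V = 0" "G = 1"
    | "u = 537289/250000" "v = 537289/250000" "g = 537289/250000" "coreC U V G"
    | "U = 1" "V = 0" "G = 1" "coreB u v g"
    | "coreB u v g" "coreC U V G"
    using assms unfolding regionB_def regionC_def by blast
  then show ?thesis
  proof cases
    case 1
    \<comment> \<open>This is the three-vertex path rooted at an end, with scaled values 1, 1 and 3
      over 1.466^2. It lies in the core, so the cycle of isolated points is left here.\<close>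
    show ?thesis unfolding 1 regionC_def coreC_def by simp
  next
    case 2
    show ?thesis using 2(4) unfolding 2(1-3) regionC_def coreC_def ring_distribs
      by (intro disjI2) (elim conjE, intro conjI; linarith)
  next
    case 3
    show ?thesis using 3(4) unfolding 3(1-3) regionC_def coreC_def coreB_def ring_distribs
      by (intro disjI2) (elim conjE, intro conjI; linarith)
  next
    case 4
    then show ?thesis unfolding regionC_def by (intro disjI2 core_BC)
  qed
qed

text \<open>Only the sets that match the new root with the root of the type \<open>A\<close> tree
  reach the top size, whence the single product \<open>v * U\<close>. The strict
  \<open>0 < v\<close> in \<open>coreA\<close> keeps it positive.\<close>

lemma core_AC:
  assumes "coreA u v g" "coreC U V G"
  shows "coreB (733/500 * (g * G)) (733/500 * (u * U)) (733/500 * (v * U))"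
proof -
  have b: "0 < u" "0 < v" "0 < g"
    "g \<le> 1398/1000" "v \<le> 1056986/1000000" "u + v \<le> 3885/1000"
    "u + v + 2 * g \<le> 5876/1000"
    "0 < U" "0 \<le> V" "0 < G"
    "G \<le> 1549541476/1000000000" "U \<le> 721/1000" "U + V \<le> 953/1000"
    "U + G \<le> 2047/1000" "2 * U + V + 2 * G \<le> 4394/1000"
    using assms unfolding coreA_def coreC_def by simp_all
  have f0: "733/500 * (v * U) \<le> 1549541476/1000000000"
  proof -
    have "0 \<le> v * (721/1000 - U)"
      by (intro mult_nonneg_nonneg; use b in linarith)+
    then show ?thesis
      unfolding ring_distribs using \<open>v \<le> 1056986/1000000\<close> by linarith
  qed
  have f1: "733/500 * (g * G) + 733/500 * (v * U) \<le> 4401/1000"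
  proof -
    have "0 \<le> v * (721/1000 - U)"
      "0 \<le> g * (1549541476/1000000000 - G)"
      by (intro mult_nonneg_nonneg; use b in linarith)+
    then show ?thesis
      unfolding ring_distribs using \<open>g \<le> 1398/1000\<close>
        \<open>v \<le> 1056986/1000000\<close> by linarith
  qed
  have f2: "733/500 * (g * G) + 733/500 * (u * U) + 733/500 * (v * U) \<le> 7157/1000"
  proof -
    have "0 \<le> u * (721/1000 - U)"
      "0 \<le> v * (721/1000 - U)"
      "0 \<le> g * (1549541476/1000000000 - G)"
      by (intro mult_nonneg_nonneg; use b in linarith)+
    then show ?thesis
      unfolding ring_distribs using \<open>g \<le> 1398/1000\<close>
        \<open>u + v \<le> 3885/1000\<close> \<open>u + v + 2 * g \<le> 5876/1000\<close>
          by linarith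
  qed
  show ?thesis
    unfolding coreB_def using b f0 f1 f2
    by (simp add: add_pos_nonneg)
qed

lemma region_AC:
  assumes "regionA u v g" "regionC U V G"
  shows "regionB (733/500 * (g * G)) (733/500 * (u * U)) (733/500 * (v * U))"
proof -
  consider "u = 733/500" "v = 733/500" "g = 733/500" "U = 1" "V = 0" "G = 1"
    | "u = 733/500" "v = 733/500" "g = 733/500" "coreC U V G"
    | "U = 1" "V = 0" "G = 1" "coreA u v g"
    | "coreA u v g" "coreC U V G"
    using assms unfolding regionA_def regionC_def by blast
  then show ?thesis
  proof cases
    case 1
    show ?thesis unfolding 1 regionB_def coreB_def by simp
  next
    case 2
    \<comment> \<open>The bound on \<open>g\<close> is exact here: it is 1.466^2 times the bound
      0.721 on \<open>U\<close>.\<close>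
    show ?thesis using 2(4) unfolding 2(1-3) regionB_def coreB_def coreC_def ring_distribs
      by (intro disjI2) (elim conjE, intro conjI; linarith)
  next
    case 3
    \<comment> \<open>Exact again: the bound on \<open>g\<close> is 1.466 times the bound 1.056986
      on \<open>v\<close>.\<close>
    show ?thesis using 3(4) unfolding 3(1-3) regionB_def coreB_def coreA_def ring_distribs
      by (intro disjI2) (elim conjE, intro conjI; linarith)
  next
    case 4
    then show ?thesis unfolding regionB_def by (intro disjI2 core_AC)
  qed
qed

lemma core_AA:
  assumes "coreA u v g" "coreA U V G"
  shows "coreC (shrink * (g * G)) 0 (shrink * (g * G + v * U + u * V))"
proof -
  have b: "0 < u" "0 < v" "0 < g"
    "g \<le> 1398/1000" "v \<le> 1056986/1000000" "u + v \<le> 3885/1000"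
    "u + v + 2 * g \<le> 5876/1000"
    "0 < U" "0 < V" "0 < G"
    "G \<le> 1398/1000" "V \<le> 1056986/1000000" "U + V \<le> 3885/1000"
    "U + V + 2 * G \<le> 5876/1000"
    using assms unfolding coreA_def by simp_all
  have f0: "shrink * (g * G + v * U + u * V) \<le> 1549541476/1000000000"
  proof -
    have "0 \<le> u * (1056986/1000000 - V)"
      "0 \<le> v * V"
      "0 \<le> v * (3885/1000 - U - V)"
      "0 \<le> g * (5876/1000 - U - V - 2 * G)"
      "0 \<le> (1398/1000 - g) * (3885/1000 - U - V)"
      "0 \<le> (1056986/1000000 - v) * U"
      "0 \<le> (1056986/1000000 - v) * (1056986/1000000 - V)"
      "0 \<le> (3885/1000 - u - v) * V"
      "0 \<le> (5876/1000 - u - v - 2 * g) * V"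
      "0 \<le> (5876/1000 - u - v - 2 * g) * (1056986/1000000 - V)"
      by (intro mult_nonneg_nonneg; use b in linarith)+
    then show ?thesis
      unfolding ring_distribs using \<open>u + v \<le> 3885/1000\<close>
        \<open>U + V \<le> 3885/1000\<close> by linarith
  qed
  \<comment> \<open>With second coordinate 0 the facets for \<open>u\<close> and
    \<open>u + v\<close> of \<open>coreC\<close> have the same left-hand side.\<close>
  have f1: "shrink * (g * G) \<le> 721/1000"
    "shrink * (g * G) \<le> 953/1000"
  proof -
    have "0 \<le> g * (1398/1000 - G)"
      by (intro mult_nonneg_nonneg; use b in linarith)+
    then show "shrink * (g * G) \<le> 721/1000"
      "shrink * (g * G) \<le> 953/1000"
      unfolding ring_distribs using \<open>g \<le> 1398/1000\<close> by linarith+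
  qed
  have f3: "shrink * (g * G) + shrink * (g * G + v * U + u * V) \<le> 2047/1000"
  proof -
    have "0 \<le> u * U"
      "0 \<le> u * V"
      "0 \<le> u * (1056986/1000000 - V)"
      "0 \<le> u * (5876/1000 - U - V - 2 * G)"
      "0 \<le> v * V"
      "0 \<le> v * (5876/1000 - U - V - 2 * G)"
      "0 \<le> (1398/1000 - g) * G"
      "0 \<le> (1056986/1000000 - v) * (1398/1000 - G)"
      "0 \<le> (3885/1000 - u - v) * (1398/1000 - G)"
      "0 \<le> (5876/1000 - u - v - 2 * g) * G"
      by (intro mult_nonneg_nonneg; use b in linarith)+
    then show ?thesis
      unfolding ring_distribs using \<open>v \<le> 1056986/1000000\<close> by linarith
  qed
  have f4: "2 * (shrink * (g * G)) + 2 * (shrink * (g * G + v * U + u * V)) \<le> 4394/1000"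
  proof -
    have "0 \<le> u * (1056986/1000000 - V)"
      "0 \<le> v * V"
      "0 \<le> (1398/1000 - g) * G"
      "0 \<le> (1056986/1000000 - v) * U"
      "0 \<le> (3885/1000 - u - v) * V"
      "0 \<le> (3885/1000 - u - v) * (1398/1000 - G)"
      "0 \<le> (5876/1000 - u - v - 2 * g) * G"
      by (intro mult_nonneg_nonneg; use b in linarith)+
    then show ?thesis
      unfolding ring_distribs using \<open>0 < v\<close> \<open>0 < U\<close> \<open>0 < V\<close>
        \<open>U + V + 2 * G \<le> 5876/1000\<close> by linarith
  qed
  show ?thesis
    unfolding coreC_def using b f0 f1 f3 f4
    by (simp add: add_pos_nonneg)
qed

lemma region_AA:
  assumes "regionA u v g" "regionA U V G"
  shows "regionC (shrink * (g * G)) 0 (shrink * (g * G + v * U + u * V))"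
proof -
  consider "u = 733/500" "v = 733/500" "g = 733/500" "U = 733/500" "V = 733/500" "G = 733/500"
    | "u = 733/500" "v = 733/500" "g = 733/500" "coreA U V G"
    | "U = 733/500" "V = 733/500" "G = 733/500" "coreA u v g"
    | "coreA u v g" "coreA U V G"
    using assms unfolding regionA_def by blast
  then show ?thesis
  proof cases
    case 1
    show ?thesis unfolding 1 regionC_def coreC_def by simp
  next
    case 2
    show ?thesis using 2(4) unfolding 2(1-3) regionC_def coreC_def coreA_def ring_distribs
      by (intro disjI2) (elim conjE, intro conjI; linarith)
  next
    case 3
    show ?thesis using 3(4) unfolding 3(1-3) regionC_def coreC_def coreA_def ring_distribs
      by (intro disjI2) (elim conjE, intro conjI; linarith)
  next
    case 4
    then show ?thesis unfolding regionC_def by (intro disjI2 core_AA)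
  qed
qed

lemma core_AB:
  assumes "coreA u v g" "coreB U V G"
  shows "coreC (shrink * (g * G)) 0 (shrink * (g * G + v * U))"
proof -
  have b: "0 < u" "0 < v" "0 < g"
    "g \<le> 1398/1000" "v \<le> 1056986/1000000" "u + v \<le> 3885/1000"
    "u + v + 2 * g \<le> 5876/1000"
    "0 < U" "0 \<le> V" "0 < G"
    "G \<le> 1549541476/1000000000" "U + G \<le> 4401/1000" "U + V + G \<le> 7157/1000"
    using assms unfolding coreA_def coreB_def by simp_all
  have f0: "shrink * (g * G + v * U) \<le> 1549541476/1000000000"
    "shrink * (g * G) + shrink * (g * G + v * U) \<le> 2047/1000"
    "2 * (shrink * (g * G)) + 2 * (shrink * (g * G + v * U)) \<le> 4394/1000"
  proof -
    have "0 \<le> (1398/1000 - g) * G"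
      "0 \<le> (1056986/1000000 - v) * U"
      by (intro mult_nonneg_nonneg; use b in linarith)+
    then show "shrink * (g * G + v * U) \<le> 1549541476/1000000000"
      "shrink * (g * G) + shrink * (g * G + v * U) \<le> 2047/1000"
      "2 * (shrink * (g * G)) + 2 * (shrink * (g * G + v * U)) \<le> 4394/1000"
      unfolding ring_distribs using \<open>G \<le> 1549541476/1000000000\<close>
        \<open>U + G \<le> 4401/1000\<close> by linarith+
  qed
  have f1: "shrink * (g * G) \<le> 721/1000"
    "shrink * (g * G) \<le> 953/1000"
  proof -
    have "0 \<le> (1398/1000 - g) * G"
      by (intro mult_nonneg_nonneg; use b in linarith)+
    then show "shrink * (g * G) \<le> 721/1000"
      "shrink * (g * G) \<le> 953/1000"
      unfolding ring_distribs using \<open>G \<le> 1549541476/1000000000\<close> by linarith+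
  qed
  show ?thesis
    unfolding coreC_def using b f0 f1
    by (simp add: add_pos_nonneg)
qed

lemma region_AB:
  assumes "regionA u v g" "regionB U V G"
  shows "regionC (shrink * (g * G)) 0 (shrink * (g * G + v * U))"
proof -
  consider "u = 733/500" "v = 733/500" "g = 733/500" "U = 537289/250000" "V = 537289/250000"
    "G = 537289/250000"
    | "u = 733/500" "v = 733/500" "g = 733/500" "coreB U V G"
    | "U = 537289/250000" "V = 537289/250000" "G = 537289/250000" "coreA u v g"
    | "coreA u v g" "coreB U V G"
    using assms unfolding regionA_def regionB_def by blast
  then show ?thesis
  proof cases
    case 1
    \<comment> \<open>The path on four vertices rooted at an inner vertex: \<open>u + g\<close>
      becomes 3/1.466, just below the bound 2.047.\<close>
    show ?thesis unfolding 1 regionC_def coreC_def by simp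
  next
    case 2
    show ?thesis using 2(4) unfolding 2(1-3) regionC_def coreC_def coreB_def ring_distribs
      by (intro disjI2) (elim conjE, intro conjI; linarith)
  next
    case 3
    show ?thesis using 3(4) unfolding 3(1-3) regionC_def coreC_def coreA_def ring_distribs
      by (intro disjI2) (elim conjE, intro conjI; linarith)
  next
    case 4
    then show ?thesis unfolding regionC_def by (intro disjI2 core_AB)
  qed
qed

lemma core_BB:
  assumes "coreB u v g" "coreB U V G"
  shows "coreC (shrink * (g * G)) 0 (shrink * (g * G))"
proof -
  have b: "0 < u" "0 \<le> v" "0 < g"
    "g \<le> 1549541476/1000000000" "u + g \<le> 4401/1000" "u + v + g \<le> 7157/1000"
    "0 < U" "0 \<le> V" "0 < G"
    "G \<le> 1549541476/1000000000" "U + G \<le> 4401/1000" "U + V + G \<le> 7157/1000"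
    using assms unfolding coreB_def by simp_all
  have f0: "shrink * (g * G) \<le> 1549541476/1000000000"
    "shrink * (g * G) \<le> 721/1000"
    "shrink * (g * G) \<le> 953/1000"
    "shrink * (g * G) + shrink * (g * G) \<le> 2047/1000"
    "2 * (shrink * (g * G)) + 2 * (shrink * (g * G)) \<le> 4394/1000"
  proof -
    have "0 \<le> g * (1549541476/1000000000 - G)"
      by (intro mult_nonneg_nonneg; use b in linarith)+
    then show "shrink * (g * G) \<le> 1549541476/1000000000"
      "shrink * (g * G) \<le> 721/1000"
      "shrink * (g * G) \<le> 953/1000"
      "shrink * (g * G) + shrink * (g * G) \<le> 2047/1000"
      "2 * (shrink * (g * G)) + 2 * (shrink * (g * G)) \<le> 4394/1000"
      unfolding ring_distribs using \<open>g \<le> 1549541476/1000000000\<close> by linarith+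
  qed
  show ?thesis
    unfolding coreC_def using b f0
    by (simp add: add_pos_nonneg)
qed

lemma region_BB:
  assumes "regionB u v g" "regionB U V G"
  shows "regionC (shrink * (g * G)) 0 (shrink * (g * G))"
proof -
  consider "u = 537289/250000" "v = 537289/250000" "g = 537289/250000" "U = 537289/250000"
    "V = 537289/250000" "G = 537289/250000"
    | "u = 537289/250000" "v = 537289/250000" "g = 537289/250000" "coreB U V G"
    | "U = 537289/250000" "V = 537289/250000" "G = 537289/250000" "coreB u v g"
    | "coreB u v g" "coreB U V G"
    using assms unfolding regionB_def by blast
  then show ?thesis
  proof cases
    case 1
    \<comment> \<open>The factor \<open>shrink\<close> cancels 1.466^4, so two one-edge trees under
      a new root have the scaled values of the empty tree. This closes the cycle of isolated
      points.\<close>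
    show ?thesis unfolding 1 regionC_def coreC_def by simp
  next
    case 2
    \<comment> \<open>The bound on \<open>u\<close> is exact: 0.721 * 1.466^2 times 1.466^2, shrunk
      by 1.466^4, is 0.721.\<close>
    show ?thesis using 2(4) unfolding 2(1-3) regionC_def coreC_def coreB_def ring_distribs
      by (intro disjI2) (elim conjE, intro conjI; linarith)
  next
    case 3
    show ?thesis using 3(4) unfolding 3(1-3) regionC_def coreC_def coreB_def ring_distribs
      by (intro disjI2) (elim conjE, intro conjI; linarith)
  next
    case 4
    then show ?thesis unfolding regionC_def by (intro disjI2 core_BB)
  qed
qed

section \<open>Leading terms\<close>

text \<open>The value \<open>c = 0\<close> is allowed, so a polynomial of smaller degree can be read
  at position \<open>k\<close> too. This makes the notion compatible with sums, which true leading
  coefficients are not.\<close>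

definition lead_at :: "real poly \<Rightarrow> nat \<Rightarrow> real \<Rightarrow> bool" where
  "lead_at p k c \<longleftrightarrow> Polynomial.degree p \<le> k \<and> coeff p k = c"

lemma lead_at_mult:
  assumes "lead_at p k c" "lead_at p' k' c'"
  shows "lead_at (p * p') (k + k') (c * c')"
proof -
  have le: "Polynomial.degree (p * p') \<le> Polynomial.degree p + Polynomial.degree p'"
    by (rule degree_mult_le)
  \<comment> \<open>If one degree falls short of its bound, both sides of the claimed equation are
    0.\<close>
  consider "Polynomial.degree p = k" "Polynomial.degree p' = k'"
    | "Polynomial.degree p < k" | "Polynomial.degree p' < k'"
    using assms unfolding lead_at_def by linarith
  then have "coeff (p * p') (k + k') = c * c'"
  proof cases
    case 1
    then show ?thesis using assms coeff_mult_degree_sum[of p p'] unfolding lead_at_def by simp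
  next
    case 2
    then have "Polynomial.degree (p * p') < k + k'" "c = 0"
      using le assms coeff_eq_0 unfolding lead_at_def by auto
    then show ?thesis by (simp add: coeff_eq_0)
  next
    case 3
    then have "Polynomial.degree (p * p') < k + k'" "c' = 0"
      using le assms coeff_eq_0 unfolding lead_at_def by auto
    then show ?thesis by (simp add: coeff_eq_0)
  qed
  then show ?thesis using le assms unfolding lead_at_def by auto
qed

lemma lead_at_add: "lead_at p k c \<Longrightarrow> lead_at p' k c' \<Longrightarrow> lead_at (p + p') k (c + c')"
  unfolding lead_at_def by (auto intro: degree_add_le)

lemma lead_at_pCons: "lead_at p k c \<Longrightarrow> lead_at (pCons 0 p) (Suc k) c"
  unfolding lead_at_def using degree_pCons_le[of 0 p] by auto

lemma lead_at_less: "lead_at p k c \<Longrightarrow> k < m \<Longrightarrow> lead_at p m 0"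
  unfolding lead_at_def by (auto intro: coeff_eq_0)

section \<open>Scaled leading coefficients and types\<close>

text \<open>The inverse of the claimed bound up to the constant 1.466^2. The exponent is a real
  number because it may be negative.\<close>

definition weight :: "nat \<Rightarrow> nat \<Rightarrow> real" where
  "weight n m = (733/500) powr (5 * real m - 4 * real n)"

lemma weight_pos: "0 < weight n m"
  unfolding weight_def by simp

text \<open>One more vertex and one more element change the exponent by 5 - 4 = 1.\<close>

lemma weight_Suc_Suc: "weight (Suc (n + n')) (Suc (m + m')) = 733/500 * (weight n m * weight n' m')"
proof -
  have "5 * real (Suc (m + m')) - 4 * real (Suc (n + n'))
      = 1 + ((5 * real m - 4 * real n) + (5 * real m' - 4 * real n'))"
    by simp
  then show ?thesis unfolding weight_def by (simp only: powr_add) simp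
qed

lemma weight_Suc: "weight (Suc (n + n')) (m + m') = shrink * (weight n m * weight n' m')"
proof -
  have "5 * real (m + m') - 4 * real (Suc (n + n'))
      = - real 4 + ((5 * real m - 4 * real n) + (5 * real m' - 4 * real n'))"
    by simp
  \<comment> \<open>Writing \<open>real 4\<close> lets \<open>powr_realpow\<close> turn the real
    power into a natural one.\<close>
  moreover have "(733/500 :: real) powr (- real 4) = shrink"
    unfolding powr_minus by (subst powr_realpow) (simp_all add: power_divide)
  ultimately show ?thesis unfolding weight_def by (simp only: powr_add)
qed

text \<open>
  The types differ in the degrees of the three polynomials, which count the dissociation sets avoiding
  the root, containing it as an isolated vertex, and all of them. Only upper bounds on the degrees are
  recorded; the regions force those leading coefficients to be nonzero that have to be. In type
  \<open>C\<close> the degree of \<open>p1\<close> may be smaller than \<open>k\<close>, with \<open>b = 0\<close>.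
\<close>
definition stateA :: "nat \<Rightarrow> real poly \<Rightarrow> real poly \<Rightarrow> real poly \<Rightarrow> bool" where
  "stateA n p0 p1 p \<longleftrightarrow> (\<exists>k a b c. lead_at p0 k a \<and> lead_at p1 (Suc k) b \<and> lead_at p (Suc k) c \<and>
     regionA (weight n (Suc k) * a) (weight n (Suc k) * b) (weight n (Suc k) * c))"

text \<open>Every maximum dissociation set contains the root together with a neighbour of
  it.\<close>

definition stateB :: "nat \<Rightarrow> real poly \<Rightarrow> real poly \<Rightarrow> real poly \<Rightarrow> bool" where
  "stateB n p0 p1 p \<longleftrightarrow> (\<exists>k a b c. lead_at p0 k a \<and> lead_at p1 k b \<and> lead_at p (Suc k) c \<and>
     regionB (weight n (Suc k) * a) (weight n (Suc k) * b) (weight n (Suc k) * c))"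

text \<open>Some maximum dissociation set avoids the root, since \<open>regionC\<close> forces
  \<open>a\<close> to be positive.\<close>

definition stateC :: "nat \<Rightarrow> real poly \<Rightarrow> real poly \<Rightarrow> real poly \<Rightarrow> bool" where
  "stateC n p0 p1 p \<longleftrightarrow> (\<exists>k a b c. lead_at p0 k a \<and> lead_at p1 k b \<and> lead_at p k c \<and>
     regionC (weight n k * a) (weight n k * b) (weight n k * c))"

section \<open>The six joins of types\<close>

context
  fixes n n' :: nat and p0 p1 p p0' p1' p' :: "real poly"
begin

text \<open>These three are the right-hand sides of \<open>gf_Node\<close>.\<close>

abbreviation (input) "node_out \<equiv> p * p'"
abbreviation (input) "node_iso \<equiv> pCons 0 (p0 * p0')"
abbreviation (input) "node_all \<equiv> p * p' + pCons 0 (p0 * p0' + (p1 * p0' + p0 * p1'))"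

lemma state_CC:
  assumes "stateC n p0 p1 p" "stateC n' p0' p1' p'"
  shows "stateA (Suc (n + n')) node_out node_iso node_all"
proof -
  from assms obtain k a b c k' a' b' c' where
    l: "lead_at p0 k a" "lead_at p1 k b" "lead_at p k c"
    and l': "lead_at p0' k' a'" "lead_at p1' k' b'" "lead_at p' k' c'"
    and "regionC (weight n k * a) (weight n k * b) (weight n k * c)"
      "regionC (weight n' k' * a') (weight n' k' * b') (weight n' k' * c')"
    unfolding stateC_def by blast
  \<comment> \<open>The summand 0 stands for \<open>p * p'\<close>, whose degree is one too small.
    The zeros written out in the following joins likewise mark terms below the top degree, so that
    the sums have the shape \<open>lead_at_add\<close> yields.\<close>
  from region_CC[OF this(7,8)]
  have "regionA (weight (Suc (n + n')) (Suc (k + k')) * (c * c'))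
      (weight (Suc (n + n')) (Suc (k + k')) * (a * a'))
      (weight (Suc (n + n')) (Suc (k + k')) * (0 + (a * a' + (b * a' + a * b'))))"
    unfolding weight_Suc_Suc by (simp add: algebra_simps add_divide_distrib)
  moreover have "lead_at node_out (k + k') (c * c')"
    by (intro lead_at_mult l l')
  moreover have "lead_at node_iso (Suc (k + k')) (a * a')"
    by (intro lead_at_pCons lead_at_mult l l')
  moreover have "lead_at node_all (Suc (k + k')) (0 + (a * a' + (b * a' + a * b')))"
    by (intro lead_at_add lead_at_pCons lead_at_mult l l' lead_at_less[OF lead_at_mult[OF l(3) l'(3)]]) simp
  ultimately show ?thesis unfolding stateA_def by blast
qed

lemma state_BC:
  assumes "stateB n p0 p1 p" "stateC n' p0' p1' p'"
  shows "stateC (Suc (n + n')) node_out node_iso node_all"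
proof -
  from assms obtain k a b c k' a' b' c' where
    l: "lead_at p0 k a" "lead_at p1 k b" "lead_at p (Suc k) c"
    and l': "lead_at p0' k' a'" "lead_at p1' k' b'" "lead_at p' k' c'"
    and "regionB (weight n (Suc k) * a) (weight n (Suc k) * b) (weight n (Suc k) * c)"
      "regionC (weight n' k' * a') (weight n' k' * b') (weight n' k' * c')"
    unfolding stateB_def stateC_def by blast
  from region_BC[OF this(7,8)]
  have "regionC (weight (Suc (n + n')) (Suc k + k') * (c * c'))
      (weight (Suc (n + n')) (Suc k + k') * (a * a'))
      (weight (Suc (n + n')) (Suc k + k') * (c * c' + (a * a' + (b * a' + a * b'))))"
    unfolding weight_Suc by (simp add: algebra_simps)
  moreover have "lead_at node_out (Suc k + k') (c * c')"
    by (intro lead_at_mult l l')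
  moreover have "lead_at node_iso (Suc k + k') (a * a')"
    unfolding add_Suc by (intro lead_at_pCons lead_at_mult l l')
  moreover have "lead_at node_all (Suc k + k') (c * c' + (a * a' + (b * a' + a * b')))"
    by (intro lead_at_add[OF lead_at_mult[OF l(3) l'(3)]])
      (unfold add_Suc, intro lead_at_add lead_at_pCons lead_at_mult l l')
  ultimately show ?thesis unfolding stateC_def by blast
qed

lemma state_AC:
  assumes "stateA n p0 p1 p" "stateC n' p0' p1' p'"
  shows "stateB (Suc (n + n')) node_out node_iso node_all"
proof -
  from assms obtain k a b c k' a' b' c' where
    l: "lead_at p0 k a" "lead_at p1 (Suc k) b" "lead_at p (Suc k) c"
    and l': "lead_at p0' k' a'" "lead_at p1' k' b'" "lead_at p' k' c'"
    and "regionA (weight n (Suc k) * a) (weight n (Suc k) * b) (weight n (Suc k) * c)"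
      "regionC (weight n' k' * a') (weight n' k' * b') (weight n' k' * c')"
    unfolding stateA_def stateC_def by blast
  from region_AC[OF this(7,8)]
  have "regionB (weight (Suc (n + n')) (Suc (Suc k + k')) * (c * c'))
      (weight (Suc (n + n')) (Suc (Suc k + k')) * (a * a'))
      (weight (Suc (n + n')) (Suc (Suc k + k')) * (0 + (0 + (b * a' + 0))))"
    unfolding weight_Suc_Suc by (simp add: algebra_simps)
  moreover have "lead_at node_out (Suc k + k') (c * c')"
    by (intro lead_at_mult l l')
  moreover have "lead_at node_iso (Suc k + k') (a * a')"
    unfolding add_Suc by (intro lead_at_pCons lead_at_mult l l')
  moreover have "lead_at node_all (Suc (Suc k + k')) (0 + (0 + (b * a' + 0)))"
  proof (intro lead_at_add lead_at_pCons)
    show "lead_at (p * p') (Suc (Suc k + k')) 0"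
      by (rule lead_at_less[OF lead_at_mult[OF l(3) l'(3)]]) simp
    show "lead_at (p0 * p0') (Suc k + k') 0"
      by (rule lead_at_less[OF lead_at_mult[OF l(1) l'(1)]]) simp
    show "lead_at (p1 * p0') (Suc k + k') (b * a')"
      by (intro lead_at_mult l l')
    show "lead_at (p0 * p1') (Suc k + k') 0"
      by (rule lead_at_less[OF lead_at_mult[OF l(1) l'(2)]]) simp
  qed
  ultimately show ?thesis unfolding stateB_def by blast
qed

lemma state_AA:
  assumes "stateA n p0 p1 p" "stateA n' p0' p1' p'"
  shows "stateC (Suc (n + n')) node_out node_iso node_all"
proof -
  from assms obtain k a b c k' a' b' c' where
    l: "lead_at p0 k a" "lead_at p1 (Suc k) b" "lead_at p (Suc k) c"
    and l': "lead_at p0' k' a'" "lead_at p1' (Suc k') b'" "lead_at p' (Suc k') c'"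
    and "regionA (weight n (Suc k) * a) (weight n (Suc k) * b) (weight n (Suc k) * c)"
      "regionA (weight n' (Suc k') * a') (weight n' (Suc k') * b') (weight n' (Suc k') * c')"
    unfolding stateA_def by blast
  from region_AA[OF this(7,8)]
  have "regionC (weight (Suc (n + n')) (Suc k + Suc k') * (c * c'))
      (weight (Suc (n + n')) (Suc k + Suc k') * 0)
      (weight (Suc (n + n')) (Suc k + Suc k') * (c * c' + (0 + (b * a' + a * b'))))"
    unfolding weight_Suc by (simp add: algebra_simps)
  moreover have "lead_at node_out (Suc k + Suc k') (c * c')"
    by (intro lead_at_mult l l')
  moreover have "lead_at node_iso (Suc k + Suc k') 0"
    by (rule lead_at_less[OF lead_at_pCons[OF lead_at_mult[OF l(1) l'(1)]]]) simp
  moreover have "lead_at node_all (Suc k + Suc k') (c * c' + (0 + (b * a' + a * b')))"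
  proof (rule lead_at_add)
    show "lead_at (p * p') (Suc k + Suc k') (c * c')"
      by (intro lead_at_mult l l')
    have "lead_at (p0 * p0') (k + Suc k') 0"
      by (rule lead_at_less[OF lead_at_mult[OF l(1) l'(1)]]) simp
    moreover have "lead_at (p1 * p0') (k + Suc k') (b * a')"
      using lead_at_mult[OF l(2) l'(1)] by simp
    moreover have "lead_at (p0 * p1') (k + Suc k') (a * b')"
      by (intro lead_at_mult l l')
    ultimately show "lead_at (pCons 0 (p0 * p0' + (p1 * p0' + p0 * p1'))) (Suc k + Suc k')
        (0 + (b * a' + a * b'))"
      unfolding add_Suc[of k] by (intro lead_at_pCons lead_at_add)
  qed
  ultimately show ?thesis unfolding stateC_def by blast
qed

lemma state_AB:
  assumes "stateA n p0 p1 p" "stateB n' p0' p1' p'"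
  shows "stateC (Suc (n + n')) node_out node_iso node_all"
proof -
  from assms obtain k a b c k' a' b' c' where
    l: "lead_at p0 k a" "lead_at p1 (Suc k) b" "lead_at p (Suc k) c"
    and l': "lead_at p0' k' a'" "lead_at p1' k' b'" "lead_at p' (Suc k') c'"
    and "regionA (weight n (Suc k) * a) (weight n (Suc k) * b) (weight n (Suc k) * c)"
      "regionB (weight n' (Suc k') * a') (weight n' (Suc k') * b') (weight n' (Suc k') * c')"
    unfolding stateA_def stateB_def by blast
  from region_AB[OF this(7,8)]
  have "regionC (weight (Suc (n + n')) (Suc k + Suc k') * (c * c'))
      (weight (Suc (n + n')) (Suc k + Suc k') * 0)
      (weight (Suc (n + n')) (Suc k + Suc k') * (c * c' + (0 + (b * a' + 0))))"
    unfolding weight_Suc by (simp add: algebra_simps)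
  moreover have "lead_at node_out (Suc k + Suc k') (c * c')"
    by (intro lead_at_mult l l')
  moreover have "lead_at node_iso (Suc k + Suc k') 0"
    by (rule lead_at_less[OF lead_at_pCons[OF lead_at_mult[OF l(1) l'(1)]]]) simp
  moreover have "lead_at node_all (Suc k + Suc k') (c * c' + (0 + (b * a' + 0)))"
  proof (rule lead_at_add)
    show "lead_at (p * p') (Suc k + Suc k') (c * c')"
      by (intro lead_at_mult l l')
    have "lead_at (p0 * p0') (k + Suc k') 0"
      by (rule lead_at_less[OF lead_at_mult[OF l(1) l'(1)]]) simp
    moreover have "lead_at (p1 * p0') (k + Suc k') (b * a')"
      using lead_at_mult[OF l(2) l'(1)] by simp
    moreover have "lead_at (p0 * p1') (k + Suc k') 0"
      by (rule lead_at_less[OF lead_at_mult[OF l(1) l'(2)]]) simp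
    ultimately show "lead_at (pCons 0 (p0 * p0' + (p1 * p0' + p0 * p1'))) (Suc k + Suc k')
        (0 + (b * a' + 0))"
      unfolding add_Suc[of k] by (intro lead_at_pCons lead_at_add)
  qed
  ultimately show ?thesis unfolding stateC_def by blast
qed

lemma state_BB:
  assumes "stateB n p0 p1 p" "stateB n' p0' p1' p'"
  shows "stateC (Suc (n + n')) node_out node_iso node_all"
proof -
  from assms obtain k a b c k' a' b' c' where
    l: "lead_at p0 k a" "lead_at p1 k b" "lead_at p (Suc k) c"
    and l': "lead_at p0' k' a'" "lead_at p1' k' b'" "lead_at p' (Suc k') c'"
    and "regionB (weight n (Suc k) * a) (weight n (Suc k) * b) (weight n (Suc k) * c)"
      "regionB (weight n' (Suc k') * a') (weight n' (Suc k') * b') (weight n' (Suc k') * c')"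
    unfolding stateB_def by blast
  from region_BB[OF this(7,8)]
  have "regionC (weight (Suc (n + n')) (Suc k + Suc k') * (c * c'))
      (weight (Suc (n + n')) (Suc k + Suc k') * 0)
      (weight (Suc (n + n')) (Suc k + Suc k') * (c * c' + 0))"
    unfolding weight_Suc by (simp add: algebra_simps)
  moreover have "lead_at node_out (Suc k + Suc k') (c * c')"
    by (intro lead_at_mult l l')
  moreover have "lead_at node_iso (Suc k + Suc k') 0"
    by (rule lead_at_less[OF lead_at_pCons[OF lead_at_mult[OF l(1) l'(1)]]]) simp
  moreover have "lead_at node_all (Suc k + Suc k') (c * c' + 0)"
  proof (rule lead_at_add)
    show "lead_at (p * p') (Suc k + Suc k') (c * c')"
      by (intro lead_at_mult l l')
    \<comment> \<open>All sets containing the new root are smaller than the maximum, so this summand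
      contributes 0 at the top position.\<close>
    have "lead_at (pCons 0 (p0 * p0' + (p1 * p0' + p0 * p1'))) (Suc (k + k'))
        (a * a' + (b * a' + a * b'))"
      by (intro lead_at_pCons lead_at_add lead_at_mult l l')
    then show "lead_at (pCons 0 (p0 * p0' + (p1 * p0' + p0 * p1'))) (Suc k + Suc k') 0"
      by (rule lead_at_less) simp
  qed
  ultimately show ?thesis unfolding stateC_def by blast
qed

end

section \<open>Induction over binary trees\<close>

definition good :: "nat \<Rightarrow> real poly \<Rightarrow> real poly \<Rightarrow> real poly \<Rightarrow> bool" where
  "good n p0 p1 p \<longleftrightarrow> stateA n p0 p1 p \<or> stateB n p0 p1 p \<or> stateC n p0 p1 p"

text \<open>Exchanging the two children leaves the node polynomials unchanged, so six of the nine
  ordered pairs of types suffice; \<open>swap\<close> provides the other three.\<close>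

lemma good_node:
  assumes "good n p0 p1 p" "good n' p0' p1' p'"
  shows "good (Suc (n + n')) (p * p') (pCons 0 (p0 * p0'))
    (p * p' + pCons 0 (p0 * p0' + (p1 * p0' + p0 * p1')))"
proof -
  have swap: "Suc (n' + n) = Suc (n + n')" "p' * p = p * p'" "p0' * p0 = p0 * p0'"
    "p1' * p0 + p0' * p1 = p1 * p0' + p0 * p1'"
    by (simp_all add: ac_simps)
  show ?thesis
    using assms unfolding good_def
    by (elim disjE)
      (use state_AA[of n p0 p1 p n' p0' p1' p'] state_AB[of n p0 p1 p n' p0' p1' p']
         state_AC[of n p0 p1 p n' p0' p1' p'] state_BB[of n p0 p1 p n' p0' p1' p']
         state_BC[of n p0 p1 p n' p0' p1' p'] state_CC[of n p0 p1 p n' p0' p1' p']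
         state_AB[of n' p0' p1' p' n p0 p1 p, unfolded swap]
         state_AC[of n' p0' p1' p' n p0 p1 p, unfolded swap]
         state_BC[of n' p0' p1' p' n p0 p1 p, unfolded swap] in blast)+
qed

lemma good_empty: "good 0 1 0 1"
proof -
  have "lead_at 1 0 1" "lead_at 0 0 0" unfolding lead_at_def by simp_all
  moreover have "regionC (weight 0 0 * 1) (weight 0 0 * 0) (weight 0 0 * 1)"
    unfolding weight_def regionC_def by simp
  ultimately show ?thesis unfolding good_def stateC_def by blast
qed

text \<open>In every region \<open>g\<close> is positive and at most 1.466^2, the value at the
  isolated point of \<open>regionB\<close>. Dividing by the weight gives the bound.\<close>

lemma goodD:
  assumes "good n p0 p1 p"
  obtains m c where "lead_at p m c" "0 < c" "c \<le> (733/500) powr (4 * real n - 5 * real m + 2)"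
proof -
  obtain m c where l: "lead_at p m c" and w: "0 < weight n m * c" "weight n m * c \<le> (733/500)\<^sup>2"
    using assms unfolding good_def stateA_def stateB_def stateC_def
      regionA_def regionB_def regionC_def coreA_def coreB_def coreC_def
    by (elim disjE exE conjE) (force simp: power2_eq_square)+
  have "0 < c" using w(1) weight_pos[of n m] by (simp add: zero_less_mult_iff)
  have "(733/500 :: real) powr (4 * real n - 5 * real m) * weight n m = 1"
    unfolding weight_def by (simp add: powr_add[symmetric])
  then have "c = (733/500) powr (4 * real n - 5 * real m) * (weight n m * c)"
    by (simp add: mult.assoc[symmetric])
  also have "\<dots> \<le> (733/500) powr (4 * real n - 5 * real m) * (733/500)\<^sup>2"
    using w(2) by (intro mult_left_mono) auto
  also have "\<dots> = (733/500) powr (4 * real n - 5 * real m + 2)"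
    by (simp add: powr_add)
  finally show ?thesis using that[OF l \<open>0 < c\<close>] by blast
qed

lemma good_diss: "distinct_tree t \<Longrightarrow> good (size t) (gf (diss_out t)) (gf (diss_iso t)) (gf (diss t))"
proof (induction t)
  case Leaf
  show ?case using good_empty by (simp add: diss_Leaf gf_def)
next
  case (Node l a r)
  have "good (Suc (size l + size r)) (gf (diss_out (Node l a r))) (gf (diss_iso (Node l a r)))
      (gf (diss (Node l a r)))"
    unfolding gf_Node[OF Node.prems] by (rule good_node) (use Node in simp_all)
  then show ?case by simp
qed

theorem theorem3p2:
  fixes V :: "'a set" and E :: "'a set set"
  assumes "subcubic_tree V E"
  shows "real (num_max_dissociation_sets V E)
           \<le> 1.466 powr (4 * real (card V) - 5 * real (dissociation_number V E) + 2)"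
proof -
  have tree: "is_tree V E" and deg: "\<And>v. v \<in> V \<Longrightarrow> Defs.degree E v \<le> 3"
    using assms unfolding subcubic_tree_def by auto
  \<comment> \<open>A leaf as root satisfies the root bound 2 of
    \<open>subcubic_tree_binary\<close>.\<close>
  then obtain r where "r \<in> V" "Defs.degree E r \<le> 1"
    using acyclic_imp_leaf[of V E] unfolding is_tree_def connected_graph_def by blast
  then obtain t where t: "distinct_tree t" "set_tree t = V" "tree_edges t = E"
    using subcubic_tree_binary[OF tree _ _ deg, of r] by auto
  obtain m c where m: "lead_at (gf (diss t)) m c" "0 < c"
      and c: "c \<le> (733/500) powr (4 * real (size t) - 5 * real m + 2)"
    using goodD[OF good_diss[OF t(1)]] .
  have coeff: "coeff (gf (diss t)) k = card {F \<in> diss t. card F = k}" for k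
    by (rule coeff_gf[OF finite_diss])
  have D: "diss t = {F. dissociation_set V E F}"
    unfolding diss_def t(2,3) ..
  \<comment> \<open>The bound \<open>m\<close> on the degree is attained because the coefficient
    \<open>c\<close> at \<open>m\<close> is positive, so \<open>m\<close> is the largest cardinality
    and \<open>c\<close> the number of sets attaining it.\<close>
  have "dissociation_number V E = m"
    unfolding dissociation_number_def D[symmetric]
  proof (rule Max_eqI)
    show "finite (card ` diss t)" by (intro finite_imageI finite_diss)
    show "y \<le> m" if "y \<in> card ` diss t" for y
    proof -
      have "{F \<in> diss t. card F = y} \<noteq> {}" using that by auto
      then have "coeff (gf (diss t)) y \<noteq> 0" unfolding coeff using finite_diss[of t] by simp
      then show ?thesis using m(1) le_degree unfolding lead_at_def by fastforce
    qed
    have "card {F \<in> diss t. card F = m} \<noteq> 0" using m coeff[of m] unfolding lead_at_def by auto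
    then have "{F \<in> diss t. card F = m} \<noteq> {}" by force
    then show "m \<in> card ` diss t" by auto
  qed
  moreover have "real (card {F \<in> diss t. card F = m}) = c"
    using m(1) coeff[of m] unfolding lead_at_def by simp
  moreover have "card V = size t" using card_set_tree[OF t(1)] t(2) by simp
  moreover have "{F. max_dissociation_set V E F} = {F \<in> diss t. card F = dissociation_number V E}"
    unfolding max_dissociation_set_def D by auto
  ultimately show ?thesis using c unfolding num_max_dissociation_sets_def by simp
qed

end
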